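(* Let $i,j\in[0,1]$ with $i+j=1$, let $\theta\in\mathbf{Bad}(i)$, and let $\Theta=\{(\theta,y):y\in[0,1]\}$. Assume $\mathbf{C}\subseteq\Theta$ is the support of a probability measure $\mu$ on $\Theta$ which satisfies a power law with exponent $\beta$. Then for any $\beta'<\beta$ there exists a (nonzero) measure $\nu$ satisfying a power law with exponent bigger than $\beta'$, such that $$\mathrm{supp}(\nu)\subseteq\mathbf{Bad}(i,j)\cap\mathbf{C}.$$ In particular, $$\dim(\mathbf{Bad}(i,j)\cap\mathbf{C})=\beta.$$
   Context: $\mathbf{Bad}(i,j)$, for $i,j\in[0,1]$ with $i+j=1$: for $i,j>0$, $$\mathbf{Bad}(i,j)=\left\{(x,y)\in\mathbb{R}^2:\exists c>0\ \forall p_1,p_2\in\mathbb{Z},\ q\in\mathbb{N},\ \ \max\left\{q|qx-p_1|^{1/i},\,q|qy-p_2|^{1/j}\right\}>c\right\},$$ while $\mathbf{Bad}(1,0)=\mathbf{BA}\times\mathbb{R}$ and $\mathbf{Bad}(0,1)=\mathbb{R}\times\mathbf{BA}$, where $\mathbf{BA}$ is the classical set of badly approximable real numbers, $\{x\in\mathbb{R}:\exists c>0\ \forall p\in\mathbb{Z},q\in\mathbb{N}:\ q|qx-p|>c\}$. $\mathbf{Bad}(i)$: for $i>0$, $\mathbf{Bad}(i)=\{x\in\mathbb{R}:\exists c>0\ \forall p\in\mathbb{Z},q\in\mathbb{N}:\ q^{1/i}|qx-p|>c\}$, and $\mathbf{Bad}(0)=\mathbb{R}$. Here $\mathbb{N}=\{1,2,\dots\}$.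 Power law: a Borel measure $\mu$ on a metric space satisfies a power law (with exponent $\beta$) if there are positive $\beta,b_1,b_2$ such that $b_1r^\beta\le\mu(B(x,r))\le b_2r^\beta$ for all $x\in\mathrm{supp}(\mu)$ and $0<r<1$. $\dim$ denotes Hausdorff dimension. *)

theory Defs
  imports "HOL-Probability.Probability"
begin

definition BA :: "real set" where
  "BA = {x. \<exists>c>0. \<forall>(p::int) (q::nat). q \<ge> 1 \<longrightarrow> real q * \<bar>real q * x - of_int p\<bar> > c}"

definition Bad1 :: "real \<Rightarrow> real set" where
  "Bad1 i =
    (if i = 0 then UNIV
     else {x. \<exists>c>0. \<forall>(p::int) (q::nat). q \<ge> 1 \<longrightarrow>
            real q powr (1 / i) * \<bar>real q * x - of_int p\<bar> > c})"

text \<open>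
  Only used for \<open>i, j \<in> {0..1}\<close> with \<open>i + j = 1\<close>, so the first two cases are
  \<open>(i, j) = (1, 0)\<close> and \<open>(i, j) = (0, 1)\<close>.
\<close>
definition Bad :: "real \<Rightarrow> real \<Rightarrow> (real \<times> real) set" where
  "Bad i j =
    (if j = 0 then BA \<times> UNIV
     else if i = 0 then UNIV \<times> BA
     else {(x, y). \<exists>c>0. \<forall>(p\<^sub>1::int) (p\<^sub>2::int) (q::nat). q \<ge> 1 \<longrightarrow>
            max (real q * \<bar>real q * x - of_int p\<^sub>1\<bar> powr (1 / i))
                (real q * \<bar>real q * y - of_int p\<^sub>2\<bar> powr (1 / j)) > c})"

text \<open>
  A metric space is represented by a subset \<open>X\<close> of a type of class \<open>metric_space\<close> with the
  induced metric, so that its balls are the sets \<open>ball x r \<inter> X\<close>.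
\<close>
definition borel_measure_on :: "'a::metric_space set \<Rightarrow> 'a measure \<Rightarrow> bool" where
  "borel_measure_on X M \<longleftrightarrow> sets M = sets (restrict_space borel X)"

definition supp :: "'a::metric_space measure \<Rightarrow> 'a set" where
  "supp M = {x \<in> space M. \<forall>r>0. emeasure M (ball x r \<inter> space M) > 0}"

text \<open>
  Open and closed balls give the same notion, with the same constants, since the bounds are
  continuous in \<open>r\<close> and the range of \<open>r\<close> is open.
\<close>
definition power_law :: "'a::metric_space measure \<Rightarrow> real \<Rightarrow> bool" where
  "power_law M \<beta> \<longleftrightarrow> \<beta> > 0 \<and>
    (\<exists>b\<^sub>1>0. \<exists>b\<^sub>2>0. \<forall>x \<in> supp M. \<forall>r. 0 < r \<and> r < 1 \<longrightarrow>
       ennreal (b\<^sub>1 * r powr \<beta>) \<le> emeasure M (ball x r \<inter> space M) \<and>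
       emeasure M (ball x r \<inter> space M) \<le> ennreal (b\<^sub>2 * r powr \<beta>))"

text \<open>
  The summand of a cover in the \<open>s\<close>-dimensional Hausdorff measure. The case \<open>s = 0\<close> is separate
  because \<open>0 powr 0 = 0\<close>, whereas the usual convention gives nonempty sets weight \<open>1\<close>.
\<close>
definition diam_pow :: "real \<Rightarrow> 'a::metric_space set \<Rightarrow> ennreal" where
  "diam_pow s U = (if U = {} then 0 else if s = 0 then 1 else ennreal (diameter U powr s))"

text \<open>
  Boundedness is required explicitly because \<^const>\<open>diameter\<close> is meaningless on unbounded sets.
\<close>
definition hausdorff_premeasure :: "real \<Rightarrow> real \<Rightarrow> 'a::metric_space set \<Rightarrow> ennreal" where
  "hausdorff_premeasure s \<delta> A =
    (INF U \<in> {U :: nat \<Rightarrow> 'a set. A \<subseteq> (\<Union>n. U n) \<and> (\<forall>n. bounded (U n) \<and> diameter (U n) \<le> \<delta>)}.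
       (\<Sum>n. diam_pow s (U n)))"

definition hausdorff_measure :: "real \<Rightarrow> 'a::metric_space set \<Rightarrow> ennreal" where
  "hausdorff_measure s A = (SUP \<delta> \<in> {0<..}. hausdorff_premeasure s \<delta> A)"

definition hausdorff_dim :: "'a::metric_space set \<Rightarrow> ennreal" where
  "hausdorff_dim A = (INF s \<in> {s. s \<ge> 0 \<and> hausdorff_measure s A = 0}. ennreal s)"

end

theory Submission imports Defs begin

text \<open>
  Everything happens on the line \<open>x = \<theta>\<close>. A rational point with denominator \<open>q\<close> is dangerous for
  \<open>(\<theta>, y)\<close> if its first coordinate is within \<open>c * q powr (- 1 - i)\<close> of \<open>\<theta>\<close> and its second one
  within \<open>c * q powr (- 1 - j)\<close> of \<open>y\<close>. The theorem asks for a large subset of the fibre of \<open>C\<close> whose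
  points have no dangerous rational points for some fixed \<open>c > 0\<close>.

  The proof sorts dangerous points by lines. By the pigeonhole principle a rational point lies on a
  line \<open>A * x + B * y + C = 0\<close> with \<open>\<bar>A\<bar> \<le> q powr i\<close> and \<open>\<bar>B\<bar> \<le> q powr j\<close>, and \<open>B \<noteq> 0\<close> because \<open>\<theta>\<close> lies
  in \<open>Bad1 i\<close> and \<open>c\<close> is small (\<open>line_not_vertical\<close>). With \<open>\<bar>B\<bar>\<close> minimal, the point threatens an interval of length
  at most comparable to \<open>1 / H\<close>, where \<open>H = q * \<bar>B\<bar>\<close> is the height. Fix a large ratio \<open>R\<close> and consider the
  points with height about \<open>R ^ n\<close> and with \<open>\<bar>B\<bar>\<close> smaller than \<open>q powr j\<close> by a factor of about \<open>T ^ k\<close>,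
  where \<open>T = R powr (1 / j)\<close>. The key fact is that in an interval of length about \<open>1 / R ^ (n - 1 - k)\<close>
  they threaten a single interval of length about \<open>1 / R ^ n\<close>, provided that the longer interval
  avoids everything dangerous of smaller height. Indeed two different lines would meet in a rational
  point with a denominator smaller by the factor \<open>T ^ k\<close>, which is itself dangerous and was already
  avoided (\<open>lines_meet_on_fibre\<close>). If \<open>k = 0\<close> this gain is missing, but then two different points
  would span a line with a coefficient \<open>B\<close> below the minimum (\<open>points_on_horizontal_line\<close>).
  For the weight \<open>(0, 1)\<close> rational numbers take the place of rational points, only the case \<open>k = 0\<close>
  occurs, and different fractions are too far apart (\<open>classical_obstacles\<close>).

  So there is one obstacle for each \<open>k\<close>, and only a proportion of about \<open>M powr (- 1 - k)\<close> of
  the descendants of an interval is lost to it, when each interval has \<open>M\<close> subintervals with ratio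
  \<open>R\<close>. These proportions have a small sum. A tree in which every node has exactly \<open>M\<close> children is
  grown greedily: a node keeps the sum of all losses that it has to expect, the potential, at most one
  half, and among three times as many candidates at least \<open>M\<close> children inherit this bound
  (\<open>good_children\<close>). The power law of \<open>\<mu>\<close> supplies \<open>3 * M\<close> separated candidates with \<open>M\<close> about
  \<open>R powr \<gamma>\<close> for any \<open>\<gamma> < \<beta>\<close> once \<open>R\<close> is large (\<open>power_law_separated_subsets\<close>), and the measure
  that distributes mass evenly over the tree has a power law with exponent \<open>log R M\<close>
  (\<open>cantor_measure_avoiding_obstacles\<close>).

  The dimension is at most \<open>\<beta>\<close> because the power law of \<open>\<mu>\<close> bounds covering numbers of its support,
  and at least \<open>\<beta>\<close> by the mass distribution principle for the measures just found.
\<close>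

section \<open>Measures with a power law\<close>

lemma borel_measure_onD:
  assumes "borel_measure_on X M"
  shows "space M = X" and "B \<in> sets borel \<Longrightarrow> B \<inter> X \<in> sets M"
proof -
  have s: "sets M = sets (restrict_space borel X)"
    using assms by (simp add: borel_measure_on_def)
  show "space M = X"
    using sets_eq_imp_space_eq[OF s] by (simp add: space_restrict_space)
  show "B \<inter> X \<in> sets M" if "B \<in> sets borel"
    using that unfolding s sets_restrict_space by auto
qed

text \<open>
  By Lindelof's theorem countably many null balls cover the complement.
\<close>
lemma null_complement_supp:
  fixes M :: "'a::{metric_space, second_countable_topology} measure"
  assumes "borel_measure_on X M"
  shows "space M - supp M \<in> null_sets M"
proof -
  note sp = borel_measure_onD(1)[OF assms] and st = borel_measure_onD(2)[OF assms]
  define F where "F = {ball x r | x r. emeasure M (ball x r \<inter> space M) = 0}"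
  have "\<And>S. S \<in> F \<Longrightarrow> open S" by (auto simp: F_def)
  then obtain F' where F': "F' \<subseteq> F" "countable F'" "\<Union>F' = \<Union>F"
    using Lindelof[of F] by blast
  have eq: "space M - supp M = (\<Union>B\<in>F'. B \<inter> space M)"
  proof -
    have "space M - supp M = \<Union>F \<inter> space M"
    proof (intro equalityI subsetI)
      fix x assume "x \<in> space M - supp M"
      then obtain r where "r > 0" "emeasure M (ball x r \<inter> space M) = 0"
        by (auto simp: supp_def)
      then have "ball x r \<in> F" "x \<in> ball x r" by (auto simp: F_def)
      then show "x \<in> \<Union>F \<inter> space M" using \<open>x \<in> space M - supp M\<close> by blast
    next
      fix x assume x: "x \<in> \<Union>F \<inter> space M"
      then obtain y r where y: "x \<in> ball y r" "emeasure M (ball y r \<inter> space M) = 0"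
        by (auto simp: F_def)
      obtain e where e: "e > 0" "ball x e \<subseteq> ball y r"
        using y(1) open_ball openE by blast
      have "emeasure M (ball x e \<inter> space M) \<le> emeasure M (ball y r \<inter> space M)"
        by (rule emeasure_mono) (use e st sp in auto)
      then show "x \<in> space M - supp M" using x e y by (auto simp: supp_def)
    qed
    then show ?thesis using F'(3) by auto
  qed
  show ?thesis unfolding eq
  proof (rule null_sets_UN'[OF F'(2)])
    fix B assume "B \<in> F'"
    then show "B \<inter> space M \<in> null_sets M"
      using F'(1) st sp by (auto simp: F_def null_sets_def)
  qed
qed

lemma supp_nonempty:
  fixes M :: "'a::{metric_space, second_countable_topology} measure"
  assumes "borel_measure_on X M" "emeasure M (space M) \<noteq> 0"
  shows "supp M \<noteq> {}"
  using null_complement_supp[OF assms(1)] assms(2) by (auto simp: null_sets_def)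

lemma closed_supp:
  assumes "borel_measure_on X M" "closed X"
  shows "closed (supp M)"
proof -
  note sp = borel_measure_onD(1)[OF assms(1)] and st = borel_measure_onD(2)[OF assms(1)]
  have "open (- supp M)"
  proof (subst open_subopen, intro ballI)
    fix x assume x: "x \<in> - supp M"
    show "\<exists>T. open T \<and> x \<in> T \<and> T \<subseteq> - supp M"
    proof (cases "x \<in> X")
      case False
      have "- X \<subseteq> - supp M" by (auto simp: supp_def sp)
      with False show ?thesis using assms(2) by (intro exI[of _ "- X"]) auto
    next
      case True
      then obtain r where r: "r > 0" "emeasure M (ball x r \<inter> space M) = 0"
        using x by (auto simp: supp_def sp)
      have "ball x r \<subseteq> - supp M"
      proof
        fix y assume "y \<in> ball x r"
        then obtain e where e: "e > 0" "ball y e \<subseteq> ball x r"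
          using open_ball openE by blast
        have "emeasure M (ball y e \<inter> space M) \<le> emeasure M (ball x r \<inter> space M)"
          by (rule emeasure_mono) (use e st sp in auto)
        then show "y \<in> - supp M" using r e by (auto simp: supp_def)
      qed
      then show ?thesis using r by (intro exI[of _ "ball x r"]) auto
    qed
  qed
  then show ?thesis by (simp add: closed_def)
qed

definition separated :: "real \<Rightarrow> 'a::metric_space set \<Rightarrow> bool" where
  "separated t S \<longleftrightarrow> finite S \<and> (\<forall>u\<in>S. \<forall>v\<in>S. u \<noteq> v \<longrightarrow> t \<le> dist u v)"

lemma separated_insert:
  "separated t S \<Longrightarrow> (\<And>s. s \<in> S \<Longrightarrow> t \<le> dist s x) \<Longrightarrow> separated t (insert x S)"
  by (auto simp: separated_def dist_commute)

lemma separated_subset: "separated t S \<Longrightarrow> S' \<subseteq> S \<Longrightarrow> separated t S'"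
  by (auto simp: separated_def intro: finite_subset)

text \<open>
  A set with fewer than \<open>b\<^sub>1 / b\<^sub>2 * (r / t) powr \<beta>\<close> points cannot be maximal among the
  \<open>t\<close>-separated subsets of a ball of radius \<open>r\<close>, since the balls of radius \<open>t\<close> around its points
  would not have enough mass to cover the ball of radius \<open>r\<close>.
\<close>
lemma power_law_separated_subsets:
  fixes M :: "'a::{metric_space, second_countable_topology} measure"
  assumes M: "borel_measure_on X M" and pl: "power_law M \<beta>"
  shows "\<exists>a>0. \<forall>y\<in>supp M. \<forall>r t. 0 < r \<and> r < 1 \<and> 0 < t \<and> t < 1 \<longrightarrow>
    (\<exists>S \<subseteq> supp M \<inter> ball y r. separated t S \<and> a * (r / t) powr \<beta> \<le> real (card S))"
proof -
  note sp = borel_measure_onD(1)[OF M] and st = borel_measure_onD(2)[OF M]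
  obtain b1 b2 where b: "b1 > 0" "b2 > 0" and
    lo: "\<And>x r. x \<in> supp M \<Longrightarrow> 0 < r \<Longrightarrow> r < 1 \<Longrightarrow> ennreal (b1 * r powr \<beta>) \<le> emeasure M (ball x r \<inter> space M)" and
    up: "\<And>x r. x \<in> supp M \<Longrightarrow> 0 < r \<Longrightarrow> r < 1 \<Longrightarrow> emeasure M (ball x r \<inter> space M) \<le> ennreal (b2 * r powr \<beta>)"
    using pl by (auto simp: power_law_def)
  define a where "a = b1 / b2"
  have "a > 0" using b by (simp add: a_def)
  moreover have "\<exists>S \<subseteq> supp M \<inter> ball y r. separated t S \<and> a * (r / t) powr \<beta> \<le> real (card S)"
    if y: "y \<in> supp M" and rt: "0 < r" "r < 1" "0 < t" "t < 1" for y r t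
  proof -
    have grow: "\<exists>S \<subseteq> supp M \<inter> ball y r. separated t S \<and> card S = m"
      if "\<And>m'. m' < m \<Longrightarrow> real m' < a * (r / t) powr \<beta>" for m
      using that
    proof (induction m)
      case 0
      show ?case by (intro exI[of _ "{}"]) (auto simp: separated_def)
    next
      case (Suc m)
      then obtain S where S: "S \<subseteq> supp M \<inter> ball y r" "separated t S" "card S = m"
        by (meson less_Suc_eq)
      have fin: "finite S" using S by (simp add: separated_def)
      have small: "real m < a * (r / t) powr \<beta>" using Suc.prems by blast
      have "\<not> supp M \<inter> ball y r \<subseteq> (\<Union>s\<in>S. ball s t)"
      proof
        assume cov: "supp M \<inter> ball y r \<subseteq> (\<Union>s\<in>S. ball s t)"
        have meas: "(\<Union>s\<in>S. ball s t \<inter> space M) \<in> sets M"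
          by (rule sets.finite_UN) (use fin st sp in auto)
        have "ennreal (b1 * r powr \<beta>) \<le> emeasure M (ball y r \<inter> space M)"
          using lo y rt by blast
        also have "\<dots> \<le> emeasure M ((\<Union>s\<in>S. ball s t \<inter> space M) \<union> (space M - supp M))"
          by (rule emeasure_mono)
             (use cov meas null_complement_supp[OF M] in \<open>auto intro!: sets.Un\<close>)
        also have "\<dots> = emeasure M (\<Union>s\<in>S. ball s t \<inter> space M)"
          by (rule emeasure_Un_null_set)
             (use meas null_complement_supp[OF M] in auto)
        also have "\<dots> \<le> (\<Sum>s\<in>S. emeasure M (ball s t \<inter> space M))"
          by (rule emeasure_subadditive_finite) (use fin st sp in auto)
        also have "\<dots> \<le> (\<Sum>s\<in>S. ennreal (b2 * t powr \<beta>))"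
          by (rule sum_mono) (use up rt S in auto)
        also have "\<dots> = ennreal (real m * (b2 * t powr \<beta>))"
          using S b by (simp add: ennreal_mult ennreal_of_nat_eq_real_of_nat)
        finally have "b1 * r powr \<beta> \<le> real m * (b2 * t powr \<beta>)"
          using b by (subst (asm) ennreal_le_iff) auto
        moreover have "real m * (b2 * t powr \<beta>) < a * (r / t) powr \<beta> * (b2 * t powr \<beta>)"
          using small b rt by (intro mult_strict_right_mono) auto
        moreover have "a * (r / t) powr \<beta> * (b2 * t powr \<beta>) = b1 * r powr \<beta>"
          using b rt by (simp add: a_def powr_divide)
        ultimately show False by simp
      qed
      then obtain x where x: "x \<in> supp M \<inter> ball y r" "\<And>s. s \<in> S \<Longrightarrow> t \<le> dist s x"
        by (meson UN_I mem_ball not_less subsetI)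
      have "x \<notin> S" using x(2)[of x] rt by auto
      then have "card (insert x S) = Suc m" using S fin by simp
      then show ?case
        using S x separated_insert[OF S(2) x(2)] by (intro exI[of _ "insert x S"]) auto
    qed
    have "\<And>m'. m' < nat \<lceil>a * (r / t) powr \<beta>\<rceil> \<Longrightarrow> real m' < a * (r / t) powr \<beta>"
      by linarith
    from grow[OF this] obtain S where S: "S \<subseteq> supp M \<inter> ball y r" "separated t S"
      "card S = nat \<lceil>a * (r / t) powr \<beta>\<rceil>" by blast
    then have "a * (r / t) powr \<beta> \<le> real (card S)" by linarith
    then show ?thesis using S by blast
  qed
  ultimately show ?thesis by blast
qed

text \<open>
  The balls of half the radius around a maximal separated set are disjoint, so that a finite
  measure bounds their number.
\<close>
lemma power_law_covering_number:
  fixes M :: "'a::metric_space measure"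
  assumes M: "borel_measure_on X M" and fin: "finite_measure M" and pl: "power_law M \<beta>"
  shows "\<exists>K>0. \<forall>t. 0 < t \<and> t < 1 \<longrightarrow>
    (\<exists>S. finite S \<and> real (card S) \<le> K * t powr (- \<beta>) \<and> supp M \<subseteq> (\<Union>s\<in>S. ball s t))"
proof -
  interpret finite_measure M by fact
  note sp = borel_measure_onD(1)[OF M] and st = borel_measure_onD(2)[OF M]
  obtain b1 where b: "b1 > 0" and
    lo: "\<And>x r. x \<in> supp M \<Longrightarrow> 0 < r \<Longrightarrow> r < 1 \<Longrightarrow> ennreal (b1 * r powr \<beta>) \<le> emeasure M (ball x r \<inter> space M)"
    using pl by (auto simp: power_law_def)
  define K where "K = (measure M (space M) + 1) / b1 * 2 powr \<beta>"
  have "K > 0" using b by (auto simp: K_def intro!: mult_pos_pos divide_pos_pos add_nonneg_pos)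
  moreover have "\<exists>S. finite S \<and> real (card S) \<le> K * t powr (- \<beta>) \<and> supp M \<subseteq> (\<Union>s\<in>S. ball s t)"
    if t: "0 < t" "t < 1" for t
  proof -
    have bound: "real (card S) \<le> K * t powr (- \<beta>)" if S: "S \<subseteq> supp M" "separated t S" for S
    proof -
      have finS: "finite S" using S by (simp add: separated_def)
      have disj: "disjoint_family_on (\<lambda>s. ball s (t/2) \<inter> space M) S"
        unfolding disjoint_family_on_def
      proof (intro ballI impI)
        fix u v assume uv: "u \<in> S" "v \<in> S" "u \<noteq> v"
        then have "t \<le> dist u v" using S by (auto simp: separated_def)
        then have "ball u (t/2) \<inter> ball v (t/2) = {}"
        proof -
          have False if "dist u w < t / 2" "dist v w < t / 2" for w
            using that \<open>t \<le> dist u v\<close> dist_triangle2[of u v w] by linarith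
          then show ?thesis by auto
        qed
        then show "ball u (t/2) \<inter> space M \<inter> (ball v (t/2) \<inter> space M) = {}" by auto
      qed
      have "ennreal (real (card S) * (b1 * (t/2) powr \<beta>)) = (\<Sum>s\<in>S. ennreal (b1 * (t/2) powr \<beta>))"
        using b by (simp add: ennreal_mult ennreal_of_nat_eq_real_of_nat)
      also have "\<dots> \<le> (\<Sum>s\<in>S. emeasure M (ball s (t/2) \<inter> space M))"
        by (rule sum_mono) (use lo t S in auto)
      also have "\<dots> = emeasure M (\<Union>s\<in>S. ball s (t/2) \<inter> space M)"
        by (rule sum_emeasure) (use finS disj st sp in auto)
      also have "\<dots> \<le> emeasure M (space M)" by (rule emeasure_space)
      also have "\<dots> = ennreal (measure M (space M))" by (simp add: emeasure_eq_measure)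
      finally have "real (card S) * (b1 * (t/2) powr \<beta>) \<le> measure M (space M)"
        by (subst (asm) ennreal_le_iff) auto
      then have "real (card S) * (b1 * (t/2) powr \<beta>) \<le> measure M (space M) + 1" by simp
      then have "real (card S) \<le> (measure M (space M) + 1) / (b1 * (t/2) powr \<beta>)"
        using b t by (subst pos_le_divide_eq) auto
      also have "\<dots> = K * t powr (-\<beta>)"
        using b t by (simp add: K_def powr_divide powr_minus field_simps)
      finally show ?thesis .
    qed
    define P where "P m \<longleftrightarrow> (\<exists>S \<subseteq> supp M. separated t S \<and> card S = m)" for m
    have P0: "P 0" unfolding P_def by (intro exI[of _ "{}"]) (auto simp: separated_def)
    have "\<And>m. P m \<Longrightarrow> m \<le> nat \<lceil>K * t powr (- \<beta>)\<rceil>"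
    proof -
      fix m assume "P m"
      then have "real m \<le> K * t powr (- \<beta>)" using bound by (auto simp: P_def)
      then show "m \<le> nat \<lceil>K * t powr (- \<beta>)\<rceil>" by linarith
    qed
    with P0 obtain m where m: "P m" "\<And>m'. P m' \<Longrightarrow> m' \<le> m"
      using GreatestI_nat[of P 0] Greatest_le_nat[of P] by blast
    obtain S where S: "S \<subseteq> supp M" "separated t S" "card S = m" using m by (auto simp: P_def)
    have finS: "finite S" using S by (simp add: separated_def)
    have "supp M \<subseteq> (\<Union>s\<in>S. ball s t)"
    proof
      fix x assume x: "x \<in> supp M"
      show "x \<in> (\<Union>s\<in>S. ball s t)"
      proof (rule ccontr)
        assume "x \<notin> (\<Union>s\<in>S. ball s t)"
        then have far: "\<And>s. s \<in> S \<Longrightarrow> t \<le> dist s x" by auto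
        then have "x \<notin> S" using t by force
        then have "P (Suc m)" unfolding P_def
          using S x finS separated_insert[OF S(2) far]
          by (intro exI[of _ "insert x S"]) auto
        then show False using m(2) by force
      qed
    qed
    then show ?thesis using S finS bound by blast
  qed
  ultimately show ?thesis by blast
qed

section \<open>Hausdorff dimension of sets that carry a power law\<close>

lemma hausdorff_premeasure_mono:
  "A \<subseteq> B \<Longrightarrow> hausdorff_premeasure s \<delta> A \<le> hausdorff_premeasure s \<delta> B"
  unfolding hausdorff_premeasure_def by (rule INF_superset_mono) auto

lemma hausdorff_measure_mono:
  "A \<subseteq> B \<Longrightarrow> hausdorff_measure s A \<le> hausdorff_measure s B"
  unfolding hausdorff_measure_def by (rule SUP_mono) (auto intro: hausdorff_premeasure_mono)

lemma hausdorff_premeasure_finite_cover: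
  fixes A :: "'a::metric_space set"
  assumes "finite S" "A \<subseteq> (\<Union>x\<in>S. ball x t)" "t > 0" "2 * t \<le> \<delta>" "s > 0"
  shows "hausdorff_premeasure s \<delta> A \<le> ennreal (real (card S) * (2 * t) powr s)"
proof -
  obtain h where h: "bij_betw h {0..<card S} S"
    using ex_bij_betw_nat_finite[OF assms(1)] by blast
  define U where "U n = (if n < card S then ball (h n) t else {})" for n
  have diam: "diameter (ball x t) \<le> 2 * t" for x :: 'a
  proof -
    have "dist y z \<le> 2 * t" if "y \<in> ball x t" "z \<in> ball x t" for y z
      using that dist_triangle2[of y z x] by (auto simp: dist_commute)
    then show ?thesis using assms(3) by (auto simp: diameter_def intro!: cSUP_least)
  qed
  have dpos: "0 \<le> diameter V" if "bounded V" for V :: "'a set"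
    using diameter_ge_0[OF that] .
  have cov: "A \<subseteq> (\<Union>n. U n)"
  proof
    fix x assume "x \<in> A"
    then obtain y where y: "y \<in> S" "x \<in> ball y t" using assms(2) by blast
    moreover have "h ` {0..<card S} = S" using h by (simp add: bij_betw_def)
    ultimately obtain n where "n < card S" "h n = y" by force
    then show "x \<in> (\<Union>n. U n)" using y by (auto simp: U_def)
  qed
  have U: "bounded (U n) \<and> diameter (U n) \<le> \<delta>" for n
    using diam[of "h n"] assms by (auto simp: U_def)
  have "hausdorff_premeasure s \<delta> A \<le> (\<Sum>n. diam_pow s (U n))"
    unfolding hausdorff_premeasure_def by (rule INF_lower) (use cov U in auto)
  also have "\<dots> = (\<Sum>n<card S. diam_pow s (U n))"
    by (rule suminf_finite) (auto simp: U_def diam_pow_def)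
  also have "\<dots> \<le> (\<Sum>n<card S. ennreal ((2 * t) powr s))"
    using diam dpos assms
    by (intro sum_mono) (auto simp: U_def diam_pow_def intro!: ennreal_leI powr_mono2)
  also have "\<dots> = ennreal (real (card S) * (2 * t) powr s)"
    by (simp add: ennreal_mult ennreal_of_nat_eq_real_of_nat)
  finally show ?thesis .
qed

lemma hausdorff_measure_supp_zero:
  fixes M :: "'a::metric_space measure"
  assumes M: "borel_measure_on X M" and fin: "finite_measure M" and pl: "power_law M \<beta>"
    and s: "\<beta> < s"
  shows "hausdorff_measure s (supp M) = 0"
proof -
  have "\<beta> > 0" using pl by (simp add: power_law_def)
  obtain K where K: "K > 0" and cov: "\<And>t. 0 < t \<Longrightarrow> t < 1 \<Longrightarrow>
    \<exists>S. finite S \<and> real (card S) \<le> K * t powr (- \<beta>) \<and> supp M \<subseteq> (\<Union>x\<in>S. ball x t)"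
    using power_law_covering_number[OF M fin pl] by auto
  have "hausdorff_premeasure s \<delta> (supp M) \<le> 0" if "\<delta> > 0" for \<delta>
  proof (rule tendsto_lowerbound)
    show "((\<lambda>t. ennreal (K * 2 powr s * t powr (s - \<beta>))) \<longlongrightarrow> 0) (at_right 0)"
    proof -
      have "((\<lambda>t. K * 2 powr s * t powr (s - \<beta>)) \<longlongrightarrow> K * 2 powr s * 0 powr (s - \<beta>)) (at_right 0)"
        using s by (intro tendsto_mult tendsto_const tendsto_powr') (auto simp: eventually_at_filter)
      from tendsto_ennrealI[OF this] show ?thesis using s by simp
    qed
    have "eventually (\<lambda>t::real. t \<in> {0<..<min 1 (\<delta>/2)}) (at_right 0)"
      using that by (intro eventually_at_right_real) auto
    then show "\<forall>\<^sub>F t in at_right 0. hausdorff_premeasure s \<delta> (supp M) \<le> ennreal (K * 2 powr s * t powr (s - \<beta>))"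
    proof eventually_elim
      case (elim t)
      then obtain S where S: "finite S" "real (card S) \<le> K * t powr (- \<beta>)" "supp M \<subseteq> (\<Union>x\<in>S. ball x t)"
        using cov[of t] by auto
      have "hausdorff_premeasure s \<delta> (supp M) \<le> ennreal (real (card S) * (2 * t) powr s)"
        by (rule hausdorff_premeasure_finite_cover) (use S elim s \<open>\<beta> > 0\<close> in auto)
      also have "\<dots> \<le> ennreal (K * t powr (- \<beta>) * (2 * t) powr s)"
        using S by (intro ennreal_leI mult_right_mono) auto
      also have "K * t powr (- \<beta>) * (2 * t) powr s = K * 2 powr s * t powr (s - \<beta>)"
        using elim by (simp add: powr_mult powr_diff powr_minus divide_simps)
      finally show ?case .
    qed
  qed auto
  then have "hausdorff_measure s (supp M) \<le> 0"
    unfolding hausdorff_measure_def by (intro SUP_least) auto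
  then show ?thesis by simp
qed

text \<open>
  The mass distribution principle: a set of diameter \<open>d\<close> meeting the support has mass at most a
  constant times \<open>d powr \<gamma>\<close>, so every cover pays for the whole mass.
\<close>
lemma mass_distribution:
  fixes N :: "'a::{metric_space, second_countable_topology} measure"
  assumes N: "borel_measure_on UNIV N" and nz: "emeasure N (space N) \<noteq> 0" and pl: "power_law N \<gamma>"
    and sub: "supp N \<subseteq> A" and s: "0 \<le> s" "s < \<gamma>"
  shows "hausdorff_measure s A \<noteq> 0"
proof -
  have sp: "space N = UNIV" and st: "\<And>B. B \<in> sets borel \<Longrightarrow> B \<in> sets N"
    using borel_measure_onD[OF N] by auto
  obtain b2 where b: "b2 > 0" and
    up: "\<And>x r. x \<in> supp N \<Longrightarrow> 0 < r \<Longrightarrow> r < 1 \<Longrightarrow> emeasure N (ball x r) \<le> ennreal (b2 * r powr \<gamma>)"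
    using pl by (auto simp: power_law_def sp)
  have up': "emeasure N (cball x d) \<le> ennreal (b2 * d powr \<gamma>)" if x: "x \<in> supp N" "0 \<le> d" "d < 1" for x d
  proof (rule tendsto_lowerbound)
    have "((\<lambda>r. b2 * r powr \<gamma>) \<longlongrightarrow> b2 * d powr \<gamma>) (at_right d)"
      using s x by (intro tendsto_mult tendsto_const tendsto_powr' tendsto_ident_at)
        (use x in \<open>auto simp: eventually_at_filter\<close>)
    then show "((\<lambda>r. ennreal (b2 * r powr \<gamma>)) \<longlongrightarrow> ennreal (b2 * d powr \<gamma>)) (at_right d)"
      by (rule tendsto_ennrealI)
    have "eventually (\<lambda>r::real. r \<in> {d<..<1}) (at_right d)"
      using x by (intro eventually_at_right_real) auto
    then show "\<forall>\<^sub>F r in at_right d. emeasure N (cball x d) \<le> ennreal (b2 * r powr \<gamma>)"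
    proof eventually_elim
      case (elim r)
      have "emeasure N (cball x d) \<le> emeasure N (ball x r)"
        by (rule emeasure_mono) (use elim st in auto)
      also have "\<dots> \<le> ennreal (b2 * r powr \<gamma>)" using up elim x by auto
      finally show ?case .
    qed
  qed auto
  have cost: "emeasure N (space N) \<le> ennreal b2 * (\<Sum>n. diam_pow s (U n))"
    if cov: "A \<subseteq> (\<Union>n. U n)" and U: "\<And>n. bounded (U n)" "\<And>n. diameter (U n) \<le> 1/2" for U :: "nat \<Rightarrow> 'a set"
  proof -
    define V where "V n = (if U n \<inter> supp N = {} then {} else cball (SOME x. x \<in> U n \<inter> supp N) (diameter (U n)))" for n
    have Vst: "V n \<in> sets N" for n using st by (auto simp: V_def)
    have UV: "U n \<inter> supp N \<subseteq> V n" for n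
    proof (cases "U n \<inter> supp N = {}")
      case False
      define x where "x = (SOME x. x \<in> U n \<inter> supp N)"
      have "x \<in> U n \<inter> supp N" unfolding x_def using False by (metis all_not_in_conv someI_ex)
      have "V n = cball x (diameter (U n))" unfolding V_def x_def using False by simp
      then show ?thesis using \<open>x \<in> U n \<inter> supp N\<close> diameter_bounded_bound[OF U(1)] by auto
    qed auto
    have Vm: "emeasure N (V n) \<le> ennreal b2 * diam_pow s (U n)" for n
    proof (cases "U n \<inter> supp N = {}")
      case False
      define x where "x = (SOME x. x \<in> U n \<inter> supp N)"
      have x: "x \<in> U n \<inter> supp N" unfolding x_def using False by (metis all_not_in_conv someI_ex)
      have d: "0 \<le> diameter (U n)" "diameter (U n) < 1"
        using diameter_ge_0[OF U(1)[of n]] U(2)[of n] by auto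
      have "emeasure N (V n) \<le> ennreal (b2 * diameter (U n) powr \<gamma>)"
        unfolding V_def x_def[symmetric] using False up'[of x] x d by simp
      also have "\<dots> = ennreal b2 * ennreal (diameter (U n) powr \<gamma>)" using b by (simp add: ennreal_mult)
      also have "ennreal (diameter (U n) powr \<gamma>) \<le> diam_pow s (U n)"
      proof (cases "s = 0")
        case True
        then show ?thesis using x d s by (auto simp: diam_pow_def powr_le1)
      next
        case False
        then show ?thesis using x d s by (auto simp: diam_pow_def intro!: ennreal_leI powr_mono')
      qed
      finally show ?thesis by (simp add: mult_left_mono)
    qed (simp add: V_def)
    have "emeasure N (space N) \<le> emeasure N ((\<Union>n. V n) \<union> (space N - supp N))"
    proof (rule emeasure_mono)
      show "space N \<subseteq> (\<Union>n. V n) \<union> (space N - supp N)" using sub cov UV by blast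
      show "(\<Union>n. V n) \<union> (space N - supp N) \<in> sets N"
        using Vst null_complement_supp[OF N] by auto
    qed
    also have "\<dots> = emeasure N (\<Union>n. V n)"
      by (rule emeasure_Un_null_set) (use Vst null_complement_supp[OF N] in auto)
    also have "\<dots> \<le> (\<Sum>n. emeasure N (V n))"
      by (rule emeasure_subadditive_countably) (use Vst in auto)
    also have "\<dots> \<le> (\<Sum>n. ennreal b2 * diam_pow s (U n))"
      by (rule suminf_le) (use Vm in auto)
    also have "\<dots> = ennreal b2 * (\<Sum>n. diam_pow s (U n))"
      by simp
    finally show ?thesis .
  qed
  have "emeasure N (space N) / ennreal b2 \<le> hausdorff_premeasure s (1/2) A"
    unfolding hausdorff_premeasure_def
  proof (rule INF_greatest)
    fix U assume "U \<in> {U :: nat \<Rightarrow> 'a set. A \<subseteq> (\<Union>n. U n) \<and> (\<forall>n. bounded (U n) \<and> diameter (U n) \<le> 1/2)}"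
    then have "emeasure N (space N) \<le> ennreal b2 * (\<Sum>n. diam_pow s (U n))" using cost by blast
    then show "emeasure N (space N) / ennreal b2 \<le> (\<Sum>n. diam_pow s (U n))"
      using b by (simp add: divide_le_posI_ennreal mult.commute)
  qed
  also have "\<dots> \<le> hausdorff_measure s A"
    unfolding hausdorff_measure_def by (rule SUP_upper) auto
  finally show ?thesis using nz b by (auto simp: ennreal_divide_eq_0_iff)
qed

text \<open>
  The dimension of a subset of the support is at most \<open>\<beta>\<close>, and measures of exponent close to
  \<open>\<beta>\<close> inside it make it at least \<open>\<beta>\<close>.
\<close>
lemma hausdorff_dim_eqI:
  fixes M :: "'a::{metric_space, second_countable_topology} measure"
  assumes M: "borel_measure_on X M" and fin: "finite_measure M" and pl: "power_law M \<beta>"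
    and A: "A \<subseteq> supp M"
    and N: "\<And>\<beta>'. \<beta>' < \<beta> \<Longrightarrow> \<exists>N \<gamma>. borel_measure_on UNIV N \<and> emeasure N (space N) \<noteq> 0 \<and>
              \<gamma> > \<beta>' \<and> power_law N \<gamma> \<and> supp N \<subseteq> A"
  shows "hausdorff_dim A = ennreal \<beta>"
proof (rule antisym)
  have "\<beta> > 0" using pl by (simp add: power_law_def)
  have zero: "hausdorff_measure s A = 0" if "\<beta> < s" for s
    using hausdorff_measure_mono[OF A, of s] hausdorff_measure_supp_zero[OF M fin pl that] by simp
  show "hausdorff_dim A \<le> ennreal \<beta>"
  proof (rule ennreal_le_epsilon)
    fix e :: real assume "e > 0"
    have "hausdorff_dim A \<le> ennreal (\<beta> + e)"
      unfolding hausdorff_dim_def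
      by (rule INF_lower2[of "\<beta> + e"]) (use zero[of "\<beta> + e"] \<open>e > 0\<close> \<open>\<beta> > 0\<close> in auto)
    then show "hausdorff_dim A \<le> ennreal \<beta> + ennreal e"
      using \<open>e > 0\<close> \<open>\<beta> > 0\<close> by simp
  qed
  show "ennreal \<beta> \<le> hausdorff_dim A"
    unfolding hausdorff_dim_def
  proof (rule INF_greatest)
    fix s assume s: "s \<in> {s. 0 \<le> s \<and> hausdorff_measure s A = 0}"
    show "ennreal \<beta> \<le> ennreal s"
    proof (rule ccontr)
      assume "\<not> ennreal \<beta> \<le> ennreal s"
      then have "s < \<beta>" by (meson ennreal_leI not_le)
      from N[OF this] obtain N \<gamma> where "borel_measure_on UNIV N" "emeasure N (space N) \<noteq> 0"
        "power_law N \<gamma>" "supp N \<subseteq> A" "s < \<gamma>" by blast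
      from mass_distribution[OF this(1-4) _ this(5)] s show False by auto
    qed
  qed
qed

section \<open>Cantor sets that avoid scattered obstacles\<close>

text \<open>
  The obstacle \<open>W n b\<close>, of level \<open>n\<close> and base level \<open>b\<close>, is thought of as a union of pieces of size
  \<open>\<rho> / R ^ n\<close> that are so sparse that a ball of radius \<open>\<rho> / R ^ b\<close> meets only one of them. Only balls
  without obstacles up to level \<open>b\<close> are considered, since in Diophantine approximation two pieces
  in one ball can be explained by a dangerous point of lower height, that is, by such an obstacle.
\<close>
definition scattered :: "real \<Rightarrow> real \<Rightarrow> (nat \<Rightarrow> nat \<Rightarrow> real set) \<Rightarrow> bool" where
  "scattered R \<rho> W \<longleftrightarrow> (\<forall>n b y. b < n \<longrightarrow>
     (\<forall>l\<le>b. \<forall>b'<l. W l b' \<inter> cball y (\<rho> / R ^ b) = {}) \<longrightarrow>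
     (\<exists>d. W n b \<inter> cball y (\<rho> / R ^ b) \<subseteq> cball d (\<rho> / R ^ n)))"

locale scattered_obstacles =
  fixes C :: "real set" and R \<rho> :: real and M :: nat and W :: "nat \<Rightarrow> nat \<Rightarrow> real set"
  assumes R: "R \<ge> 10" and \<rho>: "0 < \<rho>" and M: "M \<ge> 5"
    and closed_C: "closed C" and nonempty_C: "C \<noteq> {}"
    and many_children: "\<And>y n. y \<in> C \<Longrightarrow>
      \<exists>S \<subseteq> C \<inter> ball y (\<rho> / R ^ n / 2). separated (5 * (\<rho> / R ^ Suc n)) S \<and> 3 * M \<le> card S"
    and scattered: "scattered R \<rho> W"
begin

lemma confined:
  assumes "b < n" "\<And>l b'. l \<le> b \<Longrightarrow> b' < l \<Longrightarrow> W l b' \<inter> cball y (\<rho> / R ^ b) = {}"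
  shows "\<exists>d. W n b \<inter> cball y (\<rho> / R ^ b) \<subseteq> cball d (\<rho> / R ^ n)"
  using scattered assms unfolding scattered_def by simp

definition rad :: "nat \<Rightarrow> real" where "rad n = \<rho> / R ^ n"

lemma rad_pos [simp]: "0 < rad n" and rad_Suc: "rad n = R * rad (Suc n)"
  using R \<rho> by (auto simp: rad_def)

lemma rad_Suc_le: "10 * rad (Suc n) \<le> rad n"
  using R rad_pos[of "Suc n"] rad_Suc[of n] by (simp add: mult_right_mono)

lemma rad_tendsto_0: "rad \<longlonglongrightarrow> 0"
  unfolding rad_def using R by (intro LIMSEQ_divide_realpow_zero) simp

lemma rad_antimono: "m \<le> n \<Longrightarrow> rad n \<le> rad m"
proof (rule lift_Suc_antimono_le[of rad])
  show "rad (Suc k) \<le> rad k" for k using rad_Suc_le[of k] rad_pos[of "Suc k"] by linarith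
qed

definition meets :: "nat \<Rightarrow> nat \<Rightarrow> nat \<Rightarrow> real \<Rightarrow> bool" where
  "meets L b n y \<longleftrightarrow> b < L \<and> W L b \<inter> cball y (rad n) \<noteq> {}"

text \<open>
  For the ball of a node of level \<open>n\<close> the case of interest is \<open>m = n\<close>: obstacles of higher base level
  are taken into account only further down the tree, where they are confined.
\<close>
definition load :: "nat \<Rightarrow> nat \<Rightarrow> real \<Rightarrow> nat \<Rightarrow> real" where
  "load m n y l = (\<Sum>b\<le>m. of_bool (meets (n + l) b n y))"

text \<open>
  The weight \<open>1 / M ^ l\<close> is the proportion of a single node among the descendants \<open>l\<close> levels below,
  so that the potential bounds the proportion of descendants that the counted obstacles destroy.
\<close>
definition potential :: "nat \<Rightarrow> nat \<Rightarrow> real \<Rightarrow> real" where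
  "potential m n y = (\<Sum>l. load m n y l / real M ^ l)"

lemma load_bounds: "0 \<le> load m n y l" "load m n y l \<le> real (Suc m)"
proof -
  show "0 \<le> load m n y l" by (simp add: load_def sum_nonneg)
  have "load m n y l \<le> (\<Sum>b\<le>m. 1)" unfolding load_def by (rule sum_mono) auto
  then show "load m n y l \<le> real (Suc m)" by simp
qed

lemma geometric_summable: "summable (\<lambda>l. 1 / real M ^ l)"
  using M summable_geometric[of "1 / real M"] by (simp add: power_one_over)

lemma geometric_tail: "(\<Sum>l. 1 / real M ^ Suc l) \<le> 1/4"
proof -
  have "(\<Sum>l. 1 / real M ^ Suc l) = (\<Sum>l. 1 / real M * (1 / real M) ^ l)"
    by (simp add: power_one_over)
  also have "\<dots> = 1 / real M * (\<Sum>l. (1 / real M) ^ l)"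
    using M by (intro suminf_mult summable_geometric) auto
  also have "(\<Sum>l. (1 / real M) ^ l) = 1 / (1 - 1 / real M)"
    using M by (intro suminf_geometric) auto
  also have "1 / real M * (1 / (1 - 1 / real M)) = 1 / (real M - 1)" using M by (simp add: field_simps)
  also have "\<dots> \<le> 1/4" using M by (simp add: field_simps)
  finally show ?thesis .
qed

lemma load_summable: "summable (\<lambda>l. load m n y l / real M ^ l)"
proof (rule summable_comparison_test)
  show "summable (\<lambda>l. real (Suc m) * (1 / real M ^ l))"
    by (intro summable_mult geometric_summable)
  show "\<exists>N. \<forall>l\<ge>N. norm (load m n y l / real M ^ l) \<le> real (Suc m) * (1 / real M ^ l)"
    using load_bounds[of m n y] M by (intro exI[of _ 0]) (auto simp: divide_right_mono)
qed

text \<open>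
  An obstacle of the level of the node itself would contribute the weight one.
\<close>
lemma potential_lt_1_avoids:
  assumes "potential n n y < 1" "b < n"
  shows "W n b \<inter> cball y (rad n) = {}"
proof (rule ccontr)
  assume "W n b \<inter> cball y (rad n) \<noteq> {}"
  then have "meets (n + 0) b n y" using assms by (simp add: meets_def)
  then have "1 \<le> load n n y 0"
    unfolding load_def using assms member_le_sum[of b "{..n}" "\<lambda>b. of_bool (meets (n + 0) b n y) :: real"]
    by auto
  also have "load n n y 0 = (\<Sum>l\<in>{0}. load n n y l / real M ^ l)" by simp
  also have "\<dots> \<le> potential n n y"
    unfolding potential_def
    by (rule sum_le_suminf[OF load_summable]) (auto simp: load_bounds)
  finally show False using assms by simp
qed

text \<open>
  One obstacle for each level above \<open>n + 1\<close> enters the count, with the sum of a geometric series.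
\<close>
lemma potential_new_base:
  "potential (Suc n) (Suc n) w \<le> potential n (Suc n) w + 1/4"
proof -
  have le: "load (Suc n) (Suc n) w l / real M ^ l \<le> load n (Suc n) w l / real M ^ l + of_bool (l \<ge> 1) / real M ^ l" for l
  proof -
    have "load (Suc n) (Suc n) w l = load n (Suc n) w l + of_bool (meets (Suc n + l) (Suc n) (Suc n) w)"
      unfolding load_def by (rule sum.atMost_Suc)
    also have "\<dots> \<le> load n (Suc n) w l + of_bool (l \<ge> 1)"
      by (auto simp: meets_def)
    finally show ?thesis unfolding add_divide_distrib[symmetric] by (rule divide_right_mono) simp
  qed
  have sm: "summable (\<lambda>l. of_bool (l \<ge> 1) / real M ^ l)"
    by (rule summable_comparison_test'[OF geometric_summable, of 0]) auto
  have "potential (Suc n) (Suc n) w \<le> (\<Sum>l. load n (Suc n) w l / real M ^ l + of_bool (l \<ge> 1) / real M ^ l)"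
    unfolding potential_def by (intro suminf_le le load_summable summable_add sm)
  also have "\<dots> = potential n (Suc n) w + (\<Sum>l. of_bool (l \<ge> 1) / real M ^ l)"
    unfolding potential_def by (rule suminf_add[symmetric]) (intro load_summable sm)+
  also have "(\<Sum>l. of_bool (l \<ge> 1) / real M ^ l) = (\<Sum>l. 1 / real M ^ Suc l)"
    using suminf_split_head[OF sm] by simp
  finally show ?thesis using geometric_tail by simp
qed

lemma potential_root: "potential 0 0 y \<le> 1/4"
proof -
  have "potential 0 0 y \<le> (\<Sum>l. of_bool (l \<ge> 1) / real M ^ l)"
    unfolding potential_def
  proof (intro suminf_le load_summable)
    have "load 0 0 y l \<le> of_bool (l \<ge> 1)" for l
      by (simp add: load_def meets_def del: sum_of_bool_eq)
    then show "load 0 0 y l / real M ^ l \<le> of_bool (l \<ge> 1) / real M ^ l" for l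
      by (rule divide_right_mono) simp
    show "summable (\<lambda>l. of_bool (l \<ge> 1) / real M ^ l)"
      by (rule summable_comparison_test'[OF geometric_summable, of 0]) auto
  qed
  also have "\<dots> = (\<Sum>l. 1 / real M ^ Suc l)"
    using suminf_split_head[of "\<lambda>l. of_bool (l \<ge> 1) / real M ^ l"]
      summable_comparison_test'[OF geometric_summable, of 0 "\<lambda>l. of_bool (l \<ge> 1) / real M ^ l"] by simp
  finally show ?thesis using geometric_tail by simp
qed

text \<open>
  The invariant of the construction. Its third clause, inherited from the ancestors, records that
  the counted obstacles are confined to small balls.
\<close>
definition good :: "nat \<Rightarrow> real \<Rightarrow> bool" where
  "good n y \<longleftrightarrow> y \<in> C \<and> potential n n y \<le> 1/2 \<and>
     (\<forall>b\<le>n. \<forall>L>n. \<exists>d. W L b \<inter> cball y (rad n) \<subseteq> cball d (rad L)) \<and>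
     (\<forall>l\<le>n. \<forall>b<l. W l b \<inter> cball y (rad n) = {})"

lemma good_root:
  assumes "y \<in> C" shows "good 0 y"
  using potential_root[of y] assms confined[of 0 _ y] by (auto simp: good_def rad_def)

text \<open>
  An obstacle that enters a good ball is confined to a ball of the size of its own level, so
  that it reaches at most one of the separated children. Passing to the children therefore
  multiplies the total potential by at most \<open>M\<close>, the loss of one power of \<open>M\<close> in each weight.
\<close>
lemma sum_potential_children:
  assumes y: "good n y" and S: "S \<subseteq> ball y (rad n / 2)" "separated (5 * rad (Suc n)) S"
  shows "(\<Sum>w\<in>S. potential n (Suc n) w) \<le> real M * potential n n y"
proof -
  have fin: "finite S" using S by (simp add: separated_def)
  have sub: "cball w (rad (Suc n)) \<subseteq> cball y (rad n)" if "w \<in> S" for w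
  proof -
    have "dist w y + rad (Suc n) \<le> rad n"
    proof -
      have "w \<in> ball y (rad n / 2)" using that S(1) by blast
      then have "dist w y < rad n / 2" by (simp add: dist_commute)
      then show ?thesis using rad_Suc_le[of n] rad_pos[of "Suc n"] by linarith
    qed
    then show ?thesis unfolding cball_subset_cball_iff by blast
  qed
  have one: "(\<Sum>w\<in>S. of_bool (meets (Suc n + l) b (Suc n) w)) \<le> (of_bool (meets (n + Suc l) b n y) :: real)"
    if b: "b \<le> n" for b l
  proof (cases "\<exists>w\<in>S. meets (Suc n + l) b (Suc n) w")
    case False
    then have "(\<Sum>w\<in>S. of_bool (meets (Suc n + l) b (Suc n) w)) = (0::real)" by (intro sum.neutral) auto
    then show ?thesis by simp
  next
    case True
    then obtain w where w: "w \<in> S" "meets (Suc n + l) b (Suc n) w" by blast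
    have m: "meets (n + Suc l) b n y" using w(2) subsetD[OF sub[OF w(1)]] unfolding meets_def by auto
    obtain d where d: "W (Suc n + l) b \<inter> cball y (rad n) \<subseteq> cball d (rad (Suc n + l))"
      using y b unfolding good_def by (metis less_add_Suc1 add_Suc)
    have rr: "rad (Suc n + l) \<le> rad (Suc n)" by (rule rad_antimono) simp
    have near: "dist v d \<le> 2 * rad (Suc n)" if v: "v \<in> S" "meets (Suc n + l) b (Suc n) v" for v
    proof -
      have "W (Suc n + l) b \<inter> cball v (rad (Suc n)) \<noteq> {}" using v(2) by (simp add: meets_def)
      then obtain z where z: "z \<in> W (Suc n + l) b" "z \<in> cball v (rad (Suc n))" by blast
      then have "z \<in> cball d (rad (Suc n + l))" using d subsetD[OF sub[OF v(1)]] by blast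
      then have "dist d z \<le> rad (Suc n)" "dist v z \<le> rad (Suc n)" using z rr by auto
      then show ?thesis using dist_triangle2[of v d z] by linarith
    qed
    have only_w: "v = w" if "v \<in> S" "meets (Suc n + l) b (Suc n) v" for v
    proof (rule ccontr)
      assume "v \<noteq> w"
      then have "5 * rad (Suc n) \<le> dist v w" using S(2) that w by (auto simp: separated_def)
      also have "\<dots> \<le> 4 * rad (Suc n)"
        using near[OF that] near[OF w] dist_triangle2[of v w d] by linarith
      finally show False using rad_pos[of "Suc n"] by simp
    qed
    then have "(\<Sum>v\<in>S. of_bool (meets (Suc n + l) b (Suc n) v)) = (\<Sum>v\<in>{w}. of_bool (meets (Suc n + l) b (Suc n) v) :: real)"
    proof (intro sum.mono_neutral_right fin ballI)
      show "{w} \<subseteq> S" using w(1) by blast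
      fix v assume "v \<in> S - {w}"
      then have "\<not> meets (Suc n + l) b (Suc n) v" using only_w by blast
      then show "of_bool (meets (Suc n + l) b (Suc n) v) = (0::real)" by simp
    qed
    then show ?thesis using m by (simp del: sum_of_bool_eq)
  qed
  have load: "(\<Sum>w\<in>S. load n (Suc n) w l) \<le> load n n y (Suc l)" for l
  proof -
    have "(\<Sum>w\<in>S. load n (Suc n) w l) = (\<Sum>b\<le>n. \<Sum>w\<in>S. of_bool (meets (Suc n + l) b (Suc n) w))"
      unfolding load_def by (rule sum.swap)
    also have "\<dots> \<le> load n n y (Suc l)"
      unfolding load_def by (rule sum_mono) (use one in auto)
    finally show ?thesis .
  qed
  have "(\<Sum>w\<in>S. potential n (Suc n) w) = (\<Sum>l. \<Sum>w\<in>S. load n (Suc n) w l / real M ^ l)"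
    unfolding potential_def by (rule suminf_sum[symmetric]) (rule load_summable)
  also have "\<dots> \<le> (\<Sum>l. real M * (load n n y (Suc l) / real M ^ Suc l))"
  proof (rule suminf_le)
    show "summable (\<lambda>l. \<Sum>w\<in>S. load n (Suc n) w l / real M ^ l)"
      by (intro summable_sum load_summable)
    show "summable (\<lambda>l. real M * (load n n y (Suc l) / real M ^ Suc l))"
      using load_summable[of n n y] by (intro summable_mult) (subst summable_Suc_iff)
    fix l
    show "(\<Sum>w\<in>S. load n (Suc n) w l / real M ^ l) \<le> real M * (load n n y (Suc l) / real M ^ Suc l)"
      using load[of l] M by (simp add: sum_divide_distrib[symmetric] divide_right_mono)
  qed
  also have "\<dots> = real M * (\<Sum>l. load n n y (Suc l) / real M ^ Suc l)"
    using load_summable[of n n y] by (intro suminf_mult) (subst summable_Suc_iff)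
  also have "(\<Sum>l. load n n y (Suc l) / real M ^ Suc l) \<le> potential n n y"
    using suminf_split_head[OF load_summable[of n n y]] load_bounds(1)[of n n y 0]
    by (simp add: potential_def)
  finally show ?thesis using M by (simp add: mult_left_mono)
qed

text \<open>
  The total potential of the \<open>3 * M\<close> children is at most \<open>M / 2\<close>, hence at most \<open>2 * M\<close> of them
  have potential above one quarter.
\<close>
lemma good_children:
  assumes y: "good n y"
  shows "\<exists>S. S \<subseteq> ball y (rad n / 2) \<and> separated (5 * rad (Suc n)) S \<and> card S = M \<and> (\<forall>w\<in>S. good (Suc n) w)"
proof -
  have "y \<in> C" using y by (simp add: good_def)
  then obtain S where S: "S \<subseteq> C \<inter> ball y (rad n / 2)" "separated (5 * rad (Suc n)) S" "3 * M \<le> card S"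
    using many_children[of y n] by (auto simp: rad_def)
  have fin: "finite S" using S by (simp add: separated_def)
  define T where "T = {w \<in> S. potential n (Suc n) w \<le> 1/4}"
  have pos: "0 \<le> potential n (Suc n) w" for w
    unfolding potential_def by (intro suminf_nonneg load_summable) (simp add: load_bounds)
  have "real (card (S - T)) * (1/4) = (\<Sum>w\<in>S - T. 1/4)" by simp
  also have "\<dots> \<le> (\<Sum>w\<in>S - T. potential n (Suc n) w)" by (rule sum_mono) (auto simp: T_def)
  also have "\<dots> \<le> (\<Sum>w\<in>S. potential n (Suc n) w)" by (rule sum_mono2) (use fin pos in auto)
  also have "\<dots> \<le> real M * potential n n y" using sum_potential_children[OF y _ S(2)] S(1) by blast
  also have "\<dots> \<le> real M * (1/2)" using y by (intro mult_left_mono) (auto simp: good_def)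
  finally have "card (S - T) \<le> 2 * M" by linarith
  moreover have "card S = card T + card (S - T)"
    using fin by (subst card_Diff_subset) (auto simp: T_def card_mono intro: finite_subset)
  ultimately have "M \<le> card T" using S(3) by linarith
  then obtain T' where T': "T' \<subseteq> T" "card T' = M"
    by (meson obtain_subset_with_card_n)
  have "good (Suc n) w" if w: "w \<in> T'" for w
  proof -
    have wT: "w \<in> S" "w \<in> C" "potential n (Suc n) w \<le> 1/4" using w T' S by (auto simp: T_def)
    have pot: "potential (Suc n) (Suc n) w \<le> 1/2" using potential_new_base[of n w] wT by simp
    have "dist w y + rad (Suc n) \<le> rad n"
    proof -
      have "w \<in> ball y (rad n / 2)" using wT S(1) by blast
      then have "dist w y < rad n / 2" by (simp add: dist_commute)
      then show ?thesis using rad_Suc_le[of n] rad_pos[of "Suc n"] by linarith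
    qed
    then have sub: "cball w (rad (Suc n)) \<subseteq> cball y (rad n)" unfolding cball_subset_cball_iff by blast
    have av: "W l b \<inter> cball w (rad (Suc n)) = {}" if "l \<le> Suc n" "b < l" for l b
    proof (cases "l = Suc n")
      case True
      then show ?thesis using potential_lt_1_avoids[of "Suc n" w b] pot that by simp
    next
      case False
      then have "W l b \<inter> cball y (rad n) = {}" using y that by (simp add: good_def)
      then show ?thesis using sub by blast
    qed
    have "\<exists>d. W L b \<inter> cball w (rad (Suc n)) \<subseteq> cball d (rad L)" if b: "b \<le> Suc n" and L: "L > Suc n" for b L
    proof (cases "b = Suc n")
      case True
      then show ?thesis using confined[of b L w] av L by (simp add: rad_def)
    next
      case False
      then obtain d where "W L b \<inter> cball y (rad n) \<subseteq> cball d (rad L)"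
        using y b L unfolding good_def by (metis Suc_lessD le_SucE)
      then show ?thesis using sub by blast
    qed
    then show ?thesis using wT pot av by (auto simp: good_def)
  qed
  moreover have "T' \<subseteq> S" using T' by (auto simp: T_def)
  ultimately show ?thesis using T' S separated_subset[OF S(2)] by blast
qed

lemma child_enumeration:
  assumes "good n y"
  shows "\<exists>g. \<forall>k<M. good (Suc n) (g k) \<and> dist (g k) y < rad n / 2 \<and>
           (\<forall>k'<M. k \<noteq> k' \<longrightarrow> 5 * rad (Suc n) \<le> dist (g k) (g k'))"
proof -
  obtain S where S: "S \<subseteq> ball y (rad n / 2)" "separated (5 * rad (Suc n)) S" "card S = M"
    "\<forall>w\<in>S. good (Suc n) w" using good_children[OF assms] by blast
  then obtain g where "bij_betw g {0..<M} S"
    using ex_bij_betw_nat_finite[of S] by (auto simp: separated_def)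
  then have g: "\<And>k. k < M \<Longrightarrow> g k \<in> S" "inj_on g {0..<M}" by (auto simp: bij_betw_def)
  show ?thesis
  proof (intro exI[of _ g] allI impI conjI)
    fix k k' assume "k < M" "k' < M" "k \<noteq> k'"
    then show "5 * rad (Suc n) \<le> dist (g k) (g k')"
      using g(1) S(2) inj_onD[OF g(2), of k k'] by (auto simp: separated_def)
  next
    fix k assume "k < M"
    then have "g k \<in> S" by (rule g(1))
    then show "good (Suc n) (g k)" "dist (g k) y < rad n / 2"
      using S by (auto simp: dist_commute[of _ y])
  qed
qed

definition child :: "nat \<Rightarrow> real \<Rightarrow> nat \<Rightarrow> real" where
  "child n y = (SOME g. \<forall>k<M. good (Suc n) (g k) \<and> dist (g k) y < rad n / 2 \<and>
           (\<forall>k'<M. k \<noteq> k' \<longrightarrow> 5 * rad (Suc n) \<le> dist (g k) (g k')))"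

lemma child:
  assumes "good n y" "k < M"
  shows "good (Suc n) (child n y k)" "dist (child n y k) y < rad n / 2"
    "k' < M \<Longrightarrow> k \<noteq> k' \<Longrightarrow> 5 * rad (Suc n) \<le> dist (child n y k) (child n y k')"
  using someI_ex[OF child_enumeration[OF assms(1)]] assms(2) unfolding child_def[symmetric] by auto

text \<open>
  The nodes of level \<open>n\<close> are numbered by the integers below \<open>M ^ n\<close>, whose digits to base \<open>M\<close>
  record the path from the root.
\<close>
fun node :: "nat \<Rightarrow> nat \<Rightarrow> real" where
  "node 0 k = (SOME y. y \<in> C)"
| "node (Suc n) k = child n (node n (k div M)) (k mod M)"

lemma div_M_less: "k < M ^ Suc n \<Longrightarrow> k div M < M ^ n"
  by (simp add: less_mult_imp_div_less mult.commute)

lemma good_node: "k < M ^ n \<Longrightarrow> good n (node n k)"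
proof (induction n arbitrary: k)
  case 0
  then show ?case using good_root nonempty_C by (simp add: some_in_eq)
next
  case (Suc n)
  then show ?case using child(1)[OF Suc.IH[OF div_M_less]] M by simp
qed

lemma dist_node_parent: "k < M ^ Suc n \<Longrightarrow> dist (node (Suc n) k) (node n (k div M)) < rad n / 2"
  using child(2)[OF good_node[OF div_M_less]] M by simp

lemma node_separated:
  "k < M ^ n \<Longrightarrow> k' < M ^ n \<Longrightarrow> k \<noteq> k' \<Longrightarrow> 5 * rad n \<le> dist (node n k) (node n k')"
proof (induction n arbitrary: k k')
  case (Suc n)
  show ?case
  proof (cases "k div M = k' div M")
    case True
    then have "k mod M \<noteq> k' mod M" using Suc.prems(3) by (metis div_mult_mod_eq)
    then show ?thesis using child(3)[OF good_node[OF div_M_less[OF Suc.prems(1)]], of "k mod M" "k' mod M"] M True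
      by simp
  next
    case False
    have "5 * rad n \<le> dist (node n (k div M)) (node n (k' div M))"
      by (rule Suc.IH) (use div_M_less Suc.prems False in auto)
    moreover have "dist (node n (k div M)) (node n (k' div M)) \<le>
      dist (node (Suc n) k) (node n (k div M)) + dist (node (Suc n) k) (node (Suc n) k') +
      dist (node (Suc n) k') (node n (k' div M))"
      using dist_triangle3[of "node n (k div M)" "node n (k' div M)" "node (Suc n) k"]
        dist_triangle[of "node (Suc n) k" "node n (k' div M)" "node (Suc n) k'"] by linarith
    ultimately show ?thesis
      using dist_node_parent[OF Suc.prems(1)] dist_node_parent[OF Suc.prems(2)] rad_Suc_le[of n] rad_pos[of "Suc n"]
      by linarith
  qed
qed auto

lemma node_cball_nested:
  assumes "k < M ^ Suc n"
  shows "cball (node (Suc n) k) (rad (Suc n)) \<subseteq> cball (node n (k div M)) (rad n)"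
proof -
  have "dist (node (Suc n) k) (node n (k div M)) + rad (Suc n) \<le> rad n"
    using dist_node_parent[OF assms] rad_Suc_le[of n] rad_pos[of "Suc n"] by linarith
  then show ?thesis unfolding cball_subset_cball_iff by blast
qed

definition limit_set :: "real set" where
  "limit_set = (\<Inter>n. \<Union>k<M ^ n. cball (node n k) (rad n))"

text \<open>
  Finite unions of closed balls, so that the limit set is closed and carries the support of
  every measure that gives it full mass.
\<close>
lemma closed_limit_set: "closed limit_set"
  unfolding limit_set_def by (intro closed_INT ballI closed_UN) auto

lemma limit_set_subset: "limit_set \<subseteq> C - (\<Union>n. \<Union>b<n. W n b)"
proof
  fix z assume z: "z \<in> limit_set"
  have near: "\<exists>k<M ^ n. z \<in> cball (node n k) (rad n)" for n using z by (auto simp: limit_set_def)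
  have "z \<in> closure C"
    unfolding closure_approachable
  proof (intro allI impI)
    fix e :: real assume "e > 0"
    then obtain n where "rad n < e"
      using order_tendstoD(2)[OF rad_tendsto_0, of e] by (auto simp: eventually_sequentially)
    moreover obtain k where "k < M ^ n" "z \<in> cball (node n k) (rad n)" using near by blast
    ultimately show "\<exists>y\<in>C. dist y z < e"
      using good_node[of k n] by (intro bexI[of _ "node n k"]) (auto simp: good_def)
  qed
  moreover have "z \<notin> W n b" if "b < n" for n b
  proof -
    obtain k where "k < M ^ n" "z \<in> cball (node n k) (rad n)" using near by blast
    moreover have "W n b \<inter> cball (node n k) (rad n) = {}"
      using good_node[OF \<open>k < M ^ n\<close>] that unfolding good_def by blast
    ultimately show ?thesis by blast
  qed
  ultimately show "z \<in> C - (\<Union>n. \<Union>b<n. W n b)" using closed_C by auto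
qed

text \<open>
  The first \<open>n\<close> digits of \<open>u \<in> [0, 1)\<close> to base \<open>M\<close>, read as an integer. They turn Lebesgue
  measure into the measure that gives all nodes of a level the same mass.
\<close>
definition address :: "nat \<Rightarrow> real \<Rightarrow> nat" where
  "address n u = nat \<lfloor>real M ^ n * u\<rfloor>"

lemma address_eq_iff:
  assumes "0 \<le> u" shows "address n u = k \<longleftrightarrow> real k / real M ^ n \<le> u \<and> u < (real k + 1) / real M ^ n"
proof -
  have "address n u = k \<longleftrightarrow> \<lfloor>real M ^ n * u\<rfloor> = int k"
    using assms M by (auto simp: address_def)
  also have "\<dots> \<longleftrightarrow> real k \<le> real M ^ n * u \<and> real M ^ n * u < real k + 1"
    by (simp add: floor_eq_iff)
  also have "\<dots> \<longleftrightarrow> real k / real M ^ n \<le> u \<and> u < (real k + 1) / real M ^ n"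
    using M by (simp add: field_simps)
  finally show ?thesis .
qed

lemma address_less: 
  assumes "0 \<le> u" "u < 1" shows "address n u < M ^ n"
proof -
  have "real M ^ n * u < real M ^ n" using M assms by simp
  then have "\<lfloor>real M ^ n * u\<rfloor> < int (M ^ n)" by (simp add: floor_less_iff)
  then show ?thesis using assms by (simp add: address_def nat_less_iff)
qed

lemma address_Suc: "0 \<le> u \<Longrightarrow> address (Suc n) u div M = address n u"
proof -
  have "\<lfloor>real M ^ Suc n * u / real_of_int (int M)\<rfloor> = \<lfloor>real M ^ Suc n * u\<rfloor> div int M"
    by (rule floor_divide_real_eq_div) simp
  moreover have "real M ^ Suc n * u / real_of_int (int M) = real M ^ n * u" using M by simp
  ultimately show ?thesis
    by (simp add: address_def nat_div_distrib')
qed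

definition point :: "real \<Rightarrow> real" where
  "point u = lim (\<lambda>n. node n (address n u))"

lemma point_in_cball:
  assumes u: "0 \<le> u" "u < 1"
  shows "point u \<in> cball (node n (address n u)) (rad n)"
proof -
  define x where "x n = node n (address n u)" for n
  have "cball (x (Suc n)) (rad (Suc n)) \<subseteq> cball (x n) (rad n)" for n
    unfolding x_def using node_cball_nested[OF address_less[OF u]] address_Suc[OF u(1)] by simp
  then have nest: "cball (x m) (rad m) \<subseteq> cball (x n) (rad n)" if "n \<le> m" for n m
    using that by (rule lift_Suc_antimono_le[of "\<lambda>n. cball (x n) (rad n)"])
  have near: "x m \<in> cball (x n) (rad n)" if "n \<le> m" for n m
    using subsetD[OF nest[OF that], of "x m"] rad_pos[of m] by (simp add: less_imp_le)
  have "Cauchy x"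
  proof (rule metric_CauchyI)
    fix e :: real assume "e > 0"
    then obtain N where N: "rad N < e / 2"
      using order_tendstoD(2)[OF rad_tendsto_0, of "e/2"] by (auto simp: eventually_sequentially)
    have "dist (x m) (x n) < e" if "m \<ge> N" "n \<ge> N" for m n
      using near[OF that(1)] near[OF that(2)] N dist_triangle2[of "x m" "x n" "x N"] by (auto simp: dist_commute)
    then show "\<exists>N. \<forall>m\<ge>N. \<forall>n\<ge>N. dist (x m) (x n) < e" by blast
  qed
  then have lim: "x \<longlonglongrightarrow> point u"
    using convergent_LIMSEQ_iff[of x] Cauchy_convergent[of x] by (simp add: point_def x_def[abs_def])
  have "point u \<in> cball (x n) (rad n)"
    by (rule Lim_in_closed_set[OF closed_cball _ _ lim])
      (use near in \<open>auto simp: eventually_sequentially\<close>)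
  then show ?thesis by (simp add: x_def)
qed

lemma point_measurable [measurable]: "point \<in> borel_measurable borel"
proof -
  have "(\<lambda>u. node n (address n u)) \<in> borel_measurable borel" for n
    unfolding address_def
    by (rule measurable_compose[where N = "count_space UNIV"]) measurable
  then show ?thesis unfolding point_def by (rule borel_measurable_lim_metric)
qed

definition cantor_measure :: "real measure" where
  "cantor_measure = distr (uniform_measure lborel {0..<1}) borel point"

lemma emeasure_cantor_measure:
  assumes "A \<in> sets borel"
  shows "emeasure cantor_measure A = emeasure lborel ({0..<1} \<inter> point -` A)"
  using assms measurable_sets[OF point_measurable assms]
  by (simp add: cantor_measure_def emeasure_distr divide_ennreal_def)

lemma prob_space_cantor_measure: "prob_space cantor_measure"
  unfolding cantor_measure_def
  by (intro prob_space.prob_space_distr prob_space_uniform_measure) auto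

lemma emeasure_address:
  assumes "k < M ^ n"
  shows "emeasure lborel {u \<in> {0..<1}. address n u = k} = ennreal (1 / real M ^ n)"
proof -
  have "real k + 1 \<le> real M ^ n" using assms by (metis of_nat_Suc of_nat_power of_nat_le_iff Suc_leI add.commute)
  then have le: "(real k + 1) / real M ^ n \<le> 1" using M by simp
  have "{u \<in> {0..<1}. address n u = k} = {real k / real M ^ n ..< (real k + 1) / real M ^ n}"
  proof (intro equalityI subsetI)
    fix u assume u: "u \<in> {real k / real M ^ n ..< (real k + 1) / real M ^ n}"
    have "0 \<le> real k / real M ^ n" by simp
    then have "0 \<le> u" using u by (meson atLeastLessThan_iff order.trans)
    then show "u \<in> {u \<in> {0..<1}. address n u = k}" using u le address_eq_iff[of u n k] by auto
  next
    fix u assume "u \<in> {u \<in> {0..<1}. address n u = k}"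
    then show "u \<in> {real k / real M ^ n ..< (real k + 1) / real M ^ n}"
      using address_eq_iff[of u n k] by auto
  qed
  then show ?thesis using M by (simp add: diff_divide_distrib[symmetric] divide_right_mono)
qed

lemma supp_cantor_measure: "supp cantor_measure \<subseteq> limit_set"
proof
  fix z assume z: "z \<in> supp cantor_measure"
  show "z \<in> limit_set"
  proof (rule ccontr)
    assume "z \<notin> limit_set"
    then obtain r where r: "r > 0" "ball z r \<subseteq> - limit_set"
      using closed_limit_set by (metis ComplI openE open_Compl)
    have "point u \<in> limit_set" if "u \<in> {0..<1}" for u
      using point_in_cball[of u] address_less[of u] that by (auto simp: limit_set_def)
    then have e: "{0..<1} \<inter> point -` ball z r = {}" using r by auto
    have "emeasure cantor_measure (ball z r) = 0"
      by (subst emeasure_cantor_measure) (auto simp: e)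
    then show False using z r by (auto simp: supp_def cantor_measure_def)
  qed
qed

lemma cantor_measure_lower:
  assumes "z \<in> limit_set" "2 * rad n < r"
  shows "ennreal (1 / real M ^ n) \<le> emeasure cantor_measure (ball z r)"
proof -
  obtain k where k: "k < M ^ n" "z \<in> cball (node n k) (rad n)" using assms by (auto simp: limit_set_def)
  have "{u \<in> {0..<1}. address n u = k} \<subseteq> {0..<1} \<inter> point -` ball z r"
  proof
    fix u assume u: "u \<in> {u \<in> {0..<1}. address n u = k}"
    then have "point u \<in> cball (node n k) (rad n)" using point_in_cball[of u n] by auto
    then have "dist z (point u) < r"
      using k assms dist_triangle2[of z "point u" "node n k"] by (auto simp: dist_commute)
    then show "u \<in> {0..<1} \<inter> point -` ball z r" using u by auto
  qed
  then have "emeasure lborel {u \<in> {0..<1}. address n u = k} \<le> emeasure lborel ({0..<1} \<inter> point -` ball z r)"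
    by (rule emeasure_mono) (use measurable_sets[OF point_measurable, of "ball z r"] in auto)
  then show ?thesis using emeasure_address[OF k(1)] by (simp add: emeasure_cantor_measure)
qed

lemma cantor_measure_upper:
  assumes "z \<in> limit_set" "r \<le> rad n"
  shows "emeasure cantor_measure (ball z r) \<le> ennreal (1 / real M ^ n)"
proof -
  obtain k where k: "k < M ^ n" "z \<in> cball (node n k) (rad n)" using assms by (auto simp: limit_set_def)
  have "{0..<1} \<inter> point -` ball z r \<subseteq> {u \<in> {0..<1}. address n u = k}"
  proof
    fix u assume u: "u \<in> {0..<1} \<inter> point -` ball z r"
    define k' where "k' = address n u"
    have k': "k' < M ^ n" "point u \<in> cball (node n k') (rad n)"
      using point_in_cball[of u n] address_less[of u n] u by (auto simp: k'_def)
    have "dist (node n k) (node n k') < 5 * rad n"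
    proof -
      have "dist (node n k) z \<le> rad n" "dist (node n k') (point u) \<le> rad n" "dist z (point u) < rad n"
        using k(2) k'(2) u assms(2) by auto
      then show ?thesis
        using dist_triangle[of "node n k" "node n k'" z] dist_triangle2[of z "node n k'" "point u"] rad_pos[of n]
        by linarith
    qed
    then have "k' = k" using node_separated[OF k(1) k'(1)] by force
    then show "u \<in> {u \<in> {0..<1}. address n u = k}" using u by (auto simp: k'_def)
  qed
  then have "emeasure lborel ({0..<1} \<inter> point -` ball z r) \<le> emeasure lborel {u \<in> {0..<1}. address n u = k}"
    by (rule emeasure_mono) (simp add: address_def)
  then show ?thesis using emeasure_address[OF k(1)] by (simp add: emeasure_cantor_measure)
qed

text \<open>
  A ball of radius comparable to \<open>\<rho> / R ^ n\<close> around a point of the limit set contains a ball of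
  level \<open>n\<close> or meets just one, and \<open>1 / M ^ n\<close> is a constant multiple of the power of its radius with
  exponent \<open>log R M\<close>.
\<close>
lemma power_law_cantor_measure: "power_law cantor_measure (log R (real M))"
proof -
  define \<gamma> where "\<gamma> = log R (real M)"
  have g: "\<gamma> > 0" using R M by (simp add: \<gamma>_def)
  have Rg: "R powr \<gamma> = real M" using R M by (simp add: \<gamma>_def)
  have mass: "1 / real M ^ n = (rad n / \<rho>) powr \<gamma>" for n
    using R \<rho> by (simp add: rad_def powr_divide Rg[symmetric] powr_powr powr_realpow[symmetric] mult.commute)
  have sp: "space cantor_measure = UNIV" by (simp add: cantor_measure_def)
  define b1 where "b1 = min 1 ((1 / (2 * R * \<rho>)) powr \<gamma>)"
  define b2 where "b2 = (R / \<rho>) powr \<gamma>"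
  have small: "\<exists>n. rad n < r" if "r > 0" for r
    using order_tendstoD(2)[OF rad_tendsto_0, of r] that by (auto simp: eventually_sequentially)
  have "ennreal (b1 * r powr \<gamma>) \<le> emeasure cantor_measure (ball z r)"
    if z: "z \<in> limit_set" and r: "0 < r" "r < 1" for z r
  proof -
    define n where "n = (LEAST n. 2 * rad n < r)"
    have n: "2 * rad n < r"
      unfolding n_def by (rule LeastI_ex) (use small[of "r/2"] r in \<open>auto simp: mult.commute\<close>)
    have "b1 * r powr \<gamma> \<le> 1 / real M ^ n"
    proof (cases n)
      case 0
      have "b1 * r powr \<gamma> \<le> 1 * 1"
        using r g by (intro mult_mono powr_le1) (auto simp: b1_def)
      then show ?thesis using 0 by simp
    next
      case (Suc m)
      then have "\<not> 2 * rad m < r" using not_less_Least[of m "\<lambda>n. 2 * rad n < r"] by (simp add: n_def)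
      then have "r \<le> 2 * R * rad n" using rad_Suc[of m] Suc by simp
      then have le: "1 / (2 * R * \<rho>) * r \<le> rad n / \<rho>" using R \<rho> by (simp add: field_simps)
      have "b1 * r powr \<gamma> \<le> (1 / (2 * R * \<rho>)) powr \<gamma> * r powr \<gamma>"
        by (intro mult_right_mono) (auto simp: b1_def)
      also have "\<dots> = (1 / (2 * R * \<rho>) * r) powr \<gamma>" by (subst powr_mult) (use R \<rho> r in auto)
      also have "\<dots> \<le> (rad n / \<rho>) powr \<gamma>" using le R \<rho> r g by (intro powr_mono2) auto
      finally show ?thesis by (simp add: mass)
    qed
    then show ?thesis using cantor_measure_lower[OF z n] ennreal_leI order.trans by blast
  qed
  moreover have "emeasure cantor_measure (ball z r) \<le> ennreal (b2 * r powr \<gamma>)"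
    if z: "z \<in> limit_set" and r: "0 < r" "r < 1" for z r
  proof -
    define n where "n = (LEAST n. rad n \<le> r)"
    have n: "rad n \<le> r"
      unfolding n_def by (rule LeastI_ex) (use small[of r] r in \<open>blast intro: less_imp_le\<close>)
    have scale: "b2 * r powr \<gamma> = (R / \<rho> * r) powr \<gamma>" unfolding b2_def by (subst powr_mult) (use R \<rho> r in auto)
    show ?thesis
    proof (cases n)
      case 0
      then have "1 \<le> R / \<rho> * r" using n R \<rho> mult_mono[of 1 R \<rho> r] by (simp add: rad_def field_simps)
      then have "1 \<le> b2 * r powr \<gamma>" using g by (simp add: scale ge_one_powr_ge_zero)
      moreover have "emeasure cantor_measure (ball z r) \<le> 1"
        using prob_space_cantor_measure by (simp add: prob_space.measure_le_1)
      ultimately show ?thesis by (metis ennreal_leI ennreal_1 order.trans)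
    next
      case (Suc m)
      then have "r \<le> rad m" using not_less_Least[of m "\<lambda>n. rad n \<le> r"] by (simp add: n_def)
      then have "emeasure cantor_measure (ball z r) \<le> ennreal (1 / real M ^ m)"
        by (rule cantor_measure_upper[OF z])
      also have "1 / real M ^ m = (R * rad n / \<rho>) powr \<gamma>" using Suc rad_Suc[of m] by (simp add: mass)
      also have "ennreal \<dots> \<le> ennreal (b2 * r powr \<gamma>)"
        unfolding scale using n R \<rho> g less_imp_le[OF rad_pos[of n]]
        by (intro ennreal_leI powr_mono2) (auto simp: divide_right_mono)
      finally show ?thesis .
    qed
  qed
  moreover have "b1 > 0" "b2 > 0" using R \<rho> by (auto simp: b1_def b2_def)
  ultimately show ?thesis
    using supp_cantor_measure g unfolding power_law_def \<gamma>_def[symmetric] sp Int_UNIV_right by blast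
qed

end

text \<open>
  If the separated sets in the balls of \<open>C\<close> are as large as a power law of exponent \<open>\<beta>\<close> makes
  them, a ratio \<open>R\<close> large enough leaves room for \<open>R powr \<gamma>\<close> children per node with \<open>\<gamma> > \<beta>'\<close>. How
  large \<open>R\<close> has to be does not depend on the obstacles or on \<open>\<rho>\<close>.
\<close>
theorem cantor_measure_avoiding_obstacles:
  fixes C :: "real set"
  assumes "closed C" "C \<noteq> {}" "a > 0" "\<beta> > 0" "\<beta>' < \<beta>"
    and sep: "\<And>y r t. y \<in> C \<Longrightarrow> 0 < r \<Longrightarrow> r < 1 \<Longrightarrow> 0 < t \<Longrightarrow> t < 1 \<Longrightarrow>
      \<exists>S \<subseteq> C \<inter> ball y r. separated t S \<and> a * (r / t) powr \<beta> \<le> real (card S)"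
  shows "\<exists>R0. \<forall>R\<ge>R0. \<forall>\<rho>. \<forall>W. 0 < \<rho> \<and> \<rho> < 1 \<and> scattered R \<rho> W \<longrightarrow>
      (\<exists>(N :: real measure) \<gamma>. sets N = sets borel \<and> prob_space N \<and> \<beta>' < \<gamma> \<and> power_law N \<gamma> \<and>
        supp N \<subseteq> C - (\<Union>n. \<Union>b<n. W n b))"
proof -
  define \<gamma> where "\<gamma> = (max \<beta>' 0 + \<beta>) / 2"
  have g: "0 < \<gamma>" "\<beta>' < \<gamma>" "\<gamma> < \<beta>" using assms by (auto simp: \<gamma>_def)
  have large: "eventually (\<lambda>R::real. K \<le> R powr e) at_top" if "e > 0" for K e :: real
  proof (rule eventually_at_top_linorderI)
    fix R :: real assume R: "R \<ge> max 1 K powr (1 / e)"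
    have "K \<le> (max 1 K powr (1 / e)) powr e" using that by (simp add: powr_powr)
    also have "\<dots> \<le> R powr e" using R that by (intro powr_mono2) auto
    finally show "K \<le> R powr e" .
  qed
  have "eventually (\<lambda>R::real. 10 \<le> R) at_top" by (rule eventually_ge_at_top)
  moreover note large[of \<gamma> 5] large[of "\<beta> - \<gamma>" "6 * 10 powr \<beta> / a"]
  ultimately have "eventually (\<lambda>R::real. 10 \<le> R \<and> 5 \<le> R powr \<gamma> \<and> 6 * 10 powr \<beta> / a \<le> R powr (\<beta> - \<gamma>)) at_top"
    using g by (auto intro: eventually_conj)
  then obtain R0 where R0: "\<And>R. R \<ge> R0 \<Longrightarrow> 10 \<le> R \<and> 5 \<le> R powr \<gamma> \<and> 6 * 10 powr \<beta> / a \<le> R powr (\<beta> - \<gamma>)"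
    by (auto simp: eventually_at_top_linorder)
  show ?thesis
  proof (intro exI[of _ R0] allI impI)
    fix R \<rho> :: real and W :: "nat \<Rightarrow> nat \<Rightarrow> real set"
    assume "R0 \<le> R" and H: "0 < \<rho> \<and> \<rho> < 1 \<and> scattered R \<rho> W"
    then have R: "10 \<le> R" "5 \<le> R powr \<gamma>" "6 * 10 powr \<beta> / a \<le> R powr (\<beta> - \<gamma>)" using R0 by auto
    define M where "M = nat \<lceil>R powr \<gamma>\<rceil>"
    have M': "M \<ge> 5" "R powr \<gamma> \<le> real M" "real M \<le> R powr \<gamma> + 1" using R by (auto simp: M_def) linarith+
    have "6 * 10 powr \<beta> * R powr \<gamma> \<le> a * (R powr (\<beta> - \<gamma>) * R powr \<gamma>)"
    proof -
      have "6 * 10 powr \<beta> \<le> a * R powr (\<beta> - \<gamma>)" using R(3) \<open>a > 0\<close> by (simp add: field_simps)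
      then have "6 * 10 powr \<beta> * R powr \<gamma> \<le> a * R powr (\<beta> - \<gamma>) * R powr \<gamma>" by (rule mult_right_mono) simp
      then show ?thesis by (simp only: mult.assoc)
    qed
    also have "R powr (\<beta> - \<gamma>) * R powr \<gamma> = R powr \<beta>" using R by (simp add: powr_add[symmetric])
    finally have "6 * R powr \<gamma> \<le> a * (R / 10) powr \<beta>" using R by (simp add: powr_divide field_simps)
    then have M3: "real (3 * M) \<le> a * (R / 10) powr \<beta>" using M' R by simp
    interpret scattered_obstacles C R \<rho> M W
    proof
      fix y n assume y: "y \<in> C"
      have Rn: "1 \<le> R ^ n" using R by simp
      have "\<rho> / R ^ n \<le> \<rho> / 1" using H R Rn by (intro divide_left_mono) auto
      then have small: "\<rho> / R ^ n < 1" using H by simp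
      then have r1: "0 < \<rho> / R ^ n / 2" "\<rho> / R ^ n / 2 < 1"
        using H R by auto
      have "5 * (\<rho> / R ^ Suc n) = 5 / R * (\<rho> / R ^ n)" by simp
      also have "\<dots> \<le> 1 * (\<rho> / R ^ n)" using H R by (intro mult_right_mono) auto
      finally have t1: "5 * (\<rho> / R ^ Suc n) < 1" using small by linarith
      have t0: "0 < 5 * (\<rho> / R ^ Suc n)" using H R by simp
      have q: "\<rho> / R ^ n / 2 / (5 * (\<rho> / R ^ Suc n)) = R / 10" using H R by (simp add: field_simps)
      obtain S where S: "S \<subseteq> C \<inter> ball y (\<rho> / R ^ n / 2)" "separated (5 * (\<rho> / R ^ Suc n)) S"
        "a * (R / 10) powr \<beta> \<le> real (card S)"
        using sep[OF y r1 t0 t1] unfolding q by blast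
      have "3 * M \<le> card S" using S(3) M3 by linarith
      then show "\<exists>S \<subseteq> C \<inter> ball y (\<rho> / R ^ n / 2). separated (5 * (\<rho> / R ^ Suc n)) S \<and> 3 * M \<le> card S"
        using S by blast
    qed (use assms R H M' in auto)
    have "\<gamma> \<le> log R (real M)" by (subst le_log_iff) (use M' \<open>10 \<le> R\<close> in auto)
    then show "\<exists>(N :: real measure) \<gamma>. sets N = sets borel \<and> prob_space N \<and> \<beta>' < \<gamma> \<and> power_law N \<gamma> \<and>
        supp N \<subseteq> C - (\<Union>n. \<Union>b<n. W n b)"
      using prob_space_cantor_measure power_law_cantor_measure supp_cantor_measure limit_set_subset g
      by (intro exI[of _ cantor_measure] exI[of _ "log R (real M)"]) (auto simp: cantor_measure_def)
  qed
qed

section \<open>Dangerous rational points on a vertical line\<close>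

text \<open>
  The constant \<open>c\<close> measures how dangerous a rational point has to be to count. It is chosen after
  \<open>R\<close> and \<open>\<kappa>\<close>: the gain of \<open>R ^ \<kappa>\<close> beats the fixed powers of \<open>R\<close> that are lost in comparing
  points of the same class, and \<open>c\<close> then beats powers of \<open>R\<close> that depend on \<open>\<kappa>\<close>.
\<close>
locale weighted_approximation =
  fixes i j \<theta> c0 c R :: real and \<kappa> :: nat
  assumes ij: "0 < i" "0 < j" "i + j = 1"
    and \<theta>: "\<And>(p::int) (q::nat). q \<ge> 1 \<Longrightarrow> c0 < real q powr (1 / i) * \<bar>real q * \<theta> - of_int p\<bar>"
    and R: "R \<ge> 16" and \<kappa>: "16 * R ^ 3 * R powr (1 / j) \<le> R ^ \<kappa>"
    and c: "0 < c" "c \<le> c0" "6 * c * R * (R * (R powr (1 / j)) ^ (\<kappa> + 1))\<^sup>2 \<le> 1"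
begin

definition T :: real where "T = R powr (1 / j)"

lemma T_powr_j: "T powr j = R" and R_le_T: "R \<le> T"
proof -
  show "T powr j = R" using ij R by (simp add: T_def powr_powr)
  have "R powr 1 \<le> R powr (1 / j)" using ij R by (intro powr_mono) auto
  then show "R \<le> T" using R by (simp add: T_def)
qed

lemma T_power_powr_j: "(T ^ m) powr j = R ^ m"
proof -
  have "T > 0" using R R_le_T by linarith
  then have "(T ^ m) powr j = (T powr j) ^ m"
    by (simp add: powr_realpow[symmetric] powr_powr mult.commute)
  then show ?thesis by (simp add: T_powr_j)
qed

text \<open>
  A rational point \<open>(p\<^sub>1 / q, p\<^sub>2 / q)\<close> is dangerous for \<open>(\<theta>, y)\<close> if \<open>close p\<^sub>1 q\<close> and
  \<open>near y p\<^sub>2 q\<close>.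
\<close>
definition close :: "int \<Rightarrow> nat \<Rightarrow> bool" where
  "close p q \<longleftrightarrow> q \<ge> 1 \<and> \<bar>real q * \<theta> - of_int p\<bar> \<le> c * real q powr (- i)"

definition near :: "real \<Rightarrow> int \<Rightarrow> nat \<Rightarrow> bool" where
  "near y p q \<longleftrightarrow> \<bar>real q * y - of_int p\<bar> \<le> c * real q powr (- j)"

text \<open>
  The line \<open>A * x + B * y + C = 0\<close> passes through the point and has coefficients within the bounds
  that the pigeonhole principle provides.
\<close>
definition line :: "int \<Rightarrow> int \<Rightarrow> int \<Rightarrow> int \<Rightarrow> int \<Rightarrow> nat \<Rightarrow> bool" where
  "line A B C p\<^sub>1 p\<^sub>2 q \<longleftrightarrow> A * p\<^sub>1 + B * p\<^sub>2 + C * int q = 0 \<and> (A \<noteq> 0 \<or> B \<noteq> 0) \<and>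
     real_of_int \<bar>A\<bar> \<le> real q powr i \<and> real_of_int \<bar>B\<bar> \<le> real q powr j"

lemma powr_i_j: "q > 0 \<Longrightarrow> q powr i * q powr j = (q::real)"
  using ij by (simp add: powr_add[symmetric])

text \<open>
  The pairs of natural numbers \<open>(a, b)\<close> with \<open>a \<le> q powr i\<close> and \<open>b \<le> q powr j\<close> outnumber the residues
  modulo \<open>q\<close>.
\<close>
lemma line_exists:
  assumes q: "q \<ge> 1"
  shows "\<exists>A B C. line A B C p\<^sub>1 p\<^sub>2 q"
proof -
  define m where "m = nat \<lfloor>real q powr i\<rfloor>"
  define n where "n = nat \<lfloor>real q powr j\<rfloor>"
  have mn: "real m \<le> real q powr i" "real q powr i < real m + 1"
    "real n \<le> real q powr j" "real q powr j < real n + 1"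
    by (auto simp: m_def n_def)
  define f where "f = (\<lambda>(a, b). (int a * p\<^sub>1 + int b * p\<^sub>2) mod int q)"
  have "real q = real q powr i * real q powr j" using powr_i_j[of "real q"] q by simp
  also have "\<dots> < (real m + 1) * (real n + 1)"
    using mn by (intro mult_strict_mono) auto
  also have "\<dots> = real ((m + 1) * (n + 1))" by (simp add: algebra_simps)
  finally have "q < (m + 1) * (n + 1)" unfolding of_nat_less_iff .
  then have "card {0..<int q} < card ({0..m} \<times> {0..n})" by simp
  moreover have "f ` ({0..m} \<times> {0..n}) \<subseteq> {0..<int q}" using q by (auto simp: f_def)
  ultimately have "\<not> inj_on f ({0..m} \<times> {0..n})"
    using card_inj_on_le by (metis finite_atLeastLessThan_int not_less)
  then obtain a b a' b' where ab: "a \<le> m" "b \<le> n" "a' \<le> m" "b' \<le> n"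
    "f (a, b) = f (a', b')" "(a, b) \<noteq> (a', b')"
    by (auto simp: inj_on_def)
  have "int q dvd (int a * p\<^sub>1 + int b * p\<^sub>2) - (int a' * p\<^sub>1 + int b' * p\<^sub>2)"
    using ab(5) by (simp add: f_def mod_eq_dvd_iff)
  then obtain C where C: "(int a * p\<^sub>1 + int b * p\<^sub>2) - (int a' * p\<^sub>1 + int b' * p\<^sub>2) = int q * C"
    by (auto simp: dvd_def)
  define A B where "A = int a - int a'" and "B = int b - int b'"
  have "\<bar>A\<bar> \<le> int m" "\<bar>B\<bar> \<le> int n" using ab by (auto simp: A_def B_def)
  then have "real_of_int \<bar>A\<bar> \<le> real m" "real_of_int \<bar>B\<bar> \<le> real n" by linarith+
  then have "real_of_int \<bar>A\<bar> \<le> real q powr i" "real_of_int \<bar>B\<bar> \<le> real q powr j"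
    using mn by linarith+
  moreover have "A \<noteq> 0 \<or> B \<noteq> 0" using ab(6) by (auto simp: A_def B_def)
  moreover have "A * p\<^sub>1 + B * p\<^sub>2 + (- C) * int q = 0"
    using C by (simp add: A_def B_def algebra_simps)
  ultimately have "line A B (- C) p\<^sub>1 p\<^sub>2 q" by (simp add: line_def)
  then show ?thesis by blast
qed

text \<open>
  A vertical line through the point would give the denominator \<open>\<bar>A\<bar>\<close>, and \<open>\<theta>\<close> would be too
  close to a rational number with this denominator.
\<close>
lemma line_not_vertical:
  assumes "close p\<^sub>1 q" "line A B C p\<^sub>1 p\<^sub>2 q"
  shows "B \<noteq> 0"
proof
  assume "B = 0"
  then have A: "A \<noteq> 0" "A * p\<^sub>1 + C * int q = 0" "real_of_int \<bar>A\<bar> \<le> real q powr i"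
    using assms(2) by (auto simp: line_def)
  define a where "a = nat \<bar>A\<bar>"
  have a: "a \<ge> 1" "real a = real_of_int \<bar>A\<bar>" using A by (auto simp: a_def)
  define p where "p = (if A > 0 then - C else C)"
  have eq: "\<bar>real a * \<theta> - of_int p\<bar> = \<bar>of_int A * \<theta> + of_int C\<bar>"
  proof (cases "A > 0")
    case False
    then have "real a * \<theta> - of_int p = - (of_int A * \<theta> + of_int C)" by (simp add: a(2) p_def)
    then show ?thesis by (simp only: abs_minus_cancel)
  qed (simp add: a(2) p_def)
  have q: "real q > 0" using assms(1) by (simp add: close_def)
  have "real_of_int A * of_int p\<^sub>1 + of_int C * real q = 0"
    using A(2) by (metis of_int_0 of_int_add of_int_mult of_int_of_nat_eq)
  then have "real q * (of_int A * \<theta> + of_int C) = of_int A * (real q * \<theta> - of_int p\<^sub>1)"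
    by (simp add: algebra_simps)
  then have "real q * \<bar>of_int A * \<theta> + of_int C\<bar> = real a * \<bar>real q * \<theta> - of_int p\<^sub>1\<bar>"
    unfolding a(2) by (metis abs_mult abs_of_pos of_int_abs q)
  also have "\<dots> \<le> real q powr i * (c * real q powr (- i))"
    using A(3) a assms(1) by (intro mult_mono) (auto simp: close_def)
  also have "\<dots> = c" using q by (simp add: powr_minus)
  finally have "real q * \<bar>real a * \<theta> - of_int p\<bar> \<le> c" by (simp add: eq)
  moreover have "real a powr (1 / i) \<le> (real q powr i) powr (1 / i)"
    using A(3) a ij by (intro powr_mono2) auto
  then have "real a powr (1 / i) \<le> real q" using ij q by (simp add: powr_powr)
  then have "real a powr (1 / i) * \<bar>real a * \<theta> - of_int p\<bar> \<le> real q * \<bar>real a * \<theta> - of_int p\<bar>"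
    by (intro mult_right_mono) auto
  ultimately show False using \<theta>[OF a(1), of p] c by linarith
qed

definition slope :: "int \<Rightarrow> int \<Rightarrow> nat \<Rightarrow> nat" where
  "slope p\<^sub>1 p\<^sub>2 q = (LEAST b. \<exists>A B C. line A B C p\<^sub>1 p\<^sub>2 q \<and> b = nat \<bar>B\<bar>)"

lemma slope_le: "line A B C p\<^sub>1 p\<^sub>2 q \<Longrightarrow> slope p\<^sub>1 p\<^sub>2 q \<le> nat \<bar>B\<bar>"
  unfolding slope_def by (rule Least_le) blast

lemma slope_attained:
  assumes "close p\<^sub>1 q"
  obtains A B C where "line A B C p\<^sub>1 p\<^sub>2 q" "B > 0" "real (slope p\<^sub>1 p\<^sub>2 q) = of_int B"
proof -
  have "\<exists>b A B C. line A B C p\<^sub>1 p\<^sub>2 q \<and> b = nat \<bar>B\<bar>"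
    using line_exists[of q p\<^sub>1 p\<^sub>2] assms by (auto simp: close_def)
  from LeastI_ex[OF this] obtain A B C where L: "line A B C p\<^sub>1 p\<^sub>2 q" "slope p\<^sub>1 p\<^sub>2 q = nat \<bar>B\<bar>"
    unfolding slope_def by blast
  have "B \<noteq> 0" by (rule line_not_vertical[OF assms L(1)])
  show thesis
  proof (cases "B > 0")
    case True
    then show thesis using L that by simp
  next
    case False
    have "line (- A) (- B) (- C) p\<^sub>1 p\<^sub>2 q" using L(1) by (auto simp: line_def)
    then show thesis using that[of "- A" "- B" "- C"] L(2) False \<open>B \<noteq> 0\<close> by simp
  qed
qed

lemma slope_bounds:
  assumes "close p\<^sub>1 q"
  shows "1 \<le> slope p\<^sub>1 p\<^sub>2 q" "real (slope p\<^sub>1 p\<^sub>2 q) \<le> real q powr j"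
proof -
  obtain A B C where "line A B C p\<^sub>1 p\<^sub>2 q" "B > 0" "real (slope p\<^sub>1 p\<^sub>2 q) = of_int B"
    using slope_attained[OF assms] .
  then show "1 \<le> slope p\<^sub>1 p\<^sub>2 q" "real (slope p\<^sub>1 p\<^sub>2 q) \<le> real q powr j"
    by (auto simp: line_def)
qed

definition height :: "int \<Rightarrow> int \<Rightarrow> nat \<Rightarrow> real" where
  "height p\<^sub>1 p\<^sub>2 q = real q * real (slope p\<^sub>1 p\<^sub>2 q)"

text \<open>
  The level \<open>n\<close> is the logarithm of the height to base \<open>R\<close>, rounded up. The index \<open>k\<close> measures to
  base \<open>T\<close> how far the slope is below its upper bound \<open>q powr j\<close>. All ratios below \<open>T ^ Suc \<kappa>\<close>
  go into the class \<open>k = 0\<close>, which is treated differently.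
\<close>
definition in_class :: "nat \<Rightarrow> nat \<Rightarrow> int \<Rightarrow> int \<Rightarrow> nat \<Rightarrow> bool" where
  "in_class n k p\<^sub>1 p\<^sub>2 q \<longleftrightarrow> close p\<^sub>1 q \<and> R ^ n \<le> R * height p\<^sub>1 p\<^sub>2 q \<and> height p\<^sub>1 p\<^sub>2 q < R ^ n \<and>
     (k = 0 \<or> T ^ (k + \<kappa>) * real (slope p\<^sub>1 p\<^sub>2 q) \<le> real q powr j) \<and>
     real q powr j < T ^ Suc (k + \<kappa>) * real (slope p\<^sub>1 p\<^sub>2 q)"

text \<open>
  Points of class \<open>k\<close> have the base level \<open>b = n - 1 - k\<close>.
\<close>
definition obstacle :: "nat \<Rightarrow> nat \<Rightarrow> real set" where
  "obstacle n b = {y. \<exists>p\<^sub>1 p\<^sub>2 q. in_class n (n - Suc b) p\<^sub>1 p\<^sub>2 q \<and> near y p\<^sub>2 q}"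

lemma T_gt_1: "T > 1" using R R_le_T by linarith

text \<open>
  That \<open>k < n\<close> holds for the class \<open>k\<close> of the point, so that its base level exists, follows from
  \<open>q powr j \<le> q \<le> height p\<^sub>1 p\<^sub>2 q < R ^ n \<le> T ^ n\<close>.
\<close>
lemma in_some_obstacle:
  assumes cl: "close p\<^sub>1 q" and nr: "near y p\<^sub>2 q" and h: "height p\<^sub>1 p\<^sub>2 q < R ^ m"
  shows "\<exists>n\<le>m. \<exists>b<n. y \<in> obstacle n b"
proof -
  define s where "s = real (slope p\<^sub>1 p\<^sub>2 q)"
  have q: "real q \<ge> 1" and s: "1 \<le> s" using cl slope_bounds[OF cl] by (auto simp: close_def s_def)
  have H: "real q \<le> height p\<^sub>1 p\<^sub>2 q" using q s mult_left_mono[of 1 s "real q"] by (simp add: height_def s_def)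
  define n where "n = (LEAST n. height p\<^sub>1 p\<^sub>2 q < R ^ n)"
  have n: "height p\<^sub>1 p\<^sub>2 q < R ^ n" unfolding n_def by (rule LeastI[of _ m]) (rule h)
  have "n \<noteq> 0" using n H q by (intro notI) simp
  then obtain n' where n': "n = Suc n'" using not0_implies_Suc by blast
  then have "R ^ n' \<le> height p\<^sub>1 p\<^sub>2 q"
    using not_less_Least[of n' "\<lambda>n. height p\<^sub>1 p\<^sub>2 q < R ^ n"] by (simp add: n_def)
  then have n2: "R ^ n \<le> R * height p\<^sub>1 p\<^sub>2 q" using R by (simp add: n')
  have nm: "n \<le> m" unfolding n_def by (rule Least_le) (rule h)
  define k where "k = (LEAST k. real q powr j < T ^ Suc (k + \<kappa>) * s)"
  have ex: "\<exists>k. real q powr j < T ^ Suc (k + \<kappa>) * s"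
  proof -
    obtain k where "real q powr j < T ^ k" using real_arch_pow[OF T_gt_1] by blast
    also have "T ^ k \<le> T ^ Suc (k + \<kappa>)" using T_gt_1 by (intro power_increasing) auto
    also have "\<dots> \<le> T ^ Suc (k + \<kappa>) * s"
      using s T_gt_1 mult_left_mono[OF s, of "T ^ Suc (k + \<kappa>)"] by simp
    finally show ?thesis by blast
  qed
  have k: "real q powr j < T ^ Suc (k + \<kappa>) * s" unfolding k_def by (rule LeastI_ex[OF ex])
  have k2: "k = 0 \<or> T ^ (k + \<kappa>) * s \<le> real q powr j"
  proof (cases k)
    case (Suc k')
    then show ?thesis
      using not_less_Least[of k' "\<lambda>k. real q powr j < T ^ Suc (k + \<kappa>) * s"] by (simp add: k_def)
  qed simp
  have "k < n"
  proof (rule ccontr)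
    assume "\<not> k < n"
    then have "k \<ge> n" "k \<noteq> 0" using \<open>n \<noteq> 0\<close> by auto
    then have "T ^ (k + \<kappa>) * s \<le> real q powr j" using k2 by blast
    also have "\<dots> \<le> real q powr 1" using ij q by (intro powr_mono) auto
    also have "\<dots> < R ^ n" using q n H by simp
    also have "\<dots> \<le> T ^ n" using R R_le_T by (intro power_mono) auto
    also have "\<dots> \<le> T ^ (k + \<kappa>)" using T_gt_1 \<open>k \<ge> n\<close> by (intro power_increasing) auto
    also have "\<dots> \<le> T ^ (k + \<kappa>) * s" using s T_gt_1 mult_left_mono[OF s, of "T ^ (k + \<kappa>)"] by simp
    finally show False by simp
  qed
  have "in_class n k p\<^sub>1 p\<^sub>2 q"
    using cl n n2 k k2 by (simp add: in_class_def s_def)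
  moreover have "n - Suc (n - Suc k) = k" using \<open>k < n\<close> by simp
  ultimately have "y \<in> obstacle n (n - Suc k)" using nr by (auto simp: obstacle_def)
  then show ?thesis using nm \<open>k < n\<close> by (intro exI[of _ n] conjI exI[of _ "n - Suc k"]) auto
qed

definition rho :: real where "rho = 2 * c * R"

text \<open>
  Near a dangerous point the line passes close to \<open>(\<theta>, z)\<close>, whence \<open>z\<close> is within
  \<open>2 * c / (q * \<bar>B\<bar>)\<close> of the place where the line crosses the fibre.
\<close>
lemma line_form_bound:
  assumes "line A B C p\<^sub>1 p\<^sub>2 q" "close p\<^sub>1 q" "near z p\<^sub>2 q"
  shows "\<bar>of_int A * \<theta> + of_int B * z + of_int C\<bar> \<le> 2 * c / real q"
proof -
  have q: "real q > 0" using assms(2) by (simp add: close_def)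
  have L: "A * p\<^sub>1 + B * p\<^sub>2 + C * int q = 0" "\<bar>real_of_int A\<bar> \<le> real q powr i" "\<bar>real_of_int B\<bar> \<le> real q powr j"
    using assms(1) by (auto simp: line_def)
  have "real_of_int A * of_int p\<^sub>1 + of_int B * of_int p\<^sub>2 + of_int C * real q = 0"
    using L(1) by (metis of_int_0 of_int_add of_int_mult of_int_of_nat_eq)
  then have "real q * (of_int A * \<theta> + of_int B * z + of_int C) =
    of_int A * (real q * \<theta> - of_int p\<^sub>1) + of_int B * (real q * z - of_int p\<^sub>2)"
    by (simp add: algebra_simps)
  then have "real q * \<bar>of_int A * \<theta> + of_int B * z + of_int C\<bar> =
    \<bar>of_int A * (real q * \<theta> - of_int p\<^sub>1) + of_int B * (real q * z - of_int p\<^sub>2)\<bar>"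
    by (metis abs_mult abs_of_pos q)
  also have "\<dots> \<le> \<bar>of_int A\<bar> * \<bar>real q * \<theta> - of_int p\<^sub>1\<bar> + \<bar>of_int B\<bar> * \<bar>real q * z - of_int p\<^sub>2\<bar>"
    by (metis abs_mult abs_triangle_ineq)
  also have "\<dots> \<le> real q powr i * (c * real q powr (- i)) + real q powr j * (c * real q powr (- j))"
    using L assms by (intro add_mono mult_mono) (auto simp: close_def near_def)
  also have "\<dots> = 2 * c" using q by (simp add: powr_minus field_simps)
  finally show ?thesis using q by (simp add: pos_le_divide_eq mult.commute)
qed

lemma le_of_powr_ratio:
  fixes a b E :: real
  assumes "0 < a" "a \<le> b" "b powr (1 + j) < E * a powr (1 + j)"
  shows "b < E * a"
proof -
  have "b / a = (b / a) powr 1" using assms by simp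
  also have "\<dots> \<le> (b / a) powr (1 + j)" using assms ij by (intro powr_mono) auto
  also have "\<dots> < E" using assms by (simp add: powr_divide divide_less_eq)
  finally show ?thesis using assms by (simp add: divide_less_eq)
qed

lemma powr_1_j: "q > 0 \<Longrightarrow> q powr (1 + j) = q * q powr (j::real)"
  by (simp add: powr_add)

lemma in_class_upper:
  assumes "in_class n k p\<^sub>1 p\<^sub>2 q"
  shows "real q powr (1 + j) < R ^ n * T ^ Suc (k + \<kappa>)"
proof -
  have q: "real q > 0" using assms by (auto simp: in_class_def close_def)
  have "real q powr (1 + j) < real q * (T ^ Suc (k + \<kappa>) * real (slope p\<^sub>1 p\<^sub>2 q))"
    unfolding powr_1_j[OF q] using q assms by (intro mult_strict_left_mono) (auto simp: in_class_def)
  also have "\<dots> = height p\<^sub>1 p\<^sub>2 q * T ^ Suc (k + \<kappa>)" by (simp add: height_def)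
  also have "\<dots> \<le> R ^ n * T ^ Suc (k + \<kappa>)"
    using assms T_gt_1 by (intro mult_right_mono) (auto simp: in_class_def)
  finally show ?thesis .
qed

text \<open>
  The point where the two lines meet has a denominator smaller than \<open>q'\<close> by the factor
  \<open>T ^ (k + \<kappa>) / 2\<close>. As both linear forms are small at \<open>y\<close>, this point would be a dangerous
  one for \<open>y\<close>, of height below \<open>R ^ b\<close>.
\<close>
lemma lines_meet_on_fibre:
  assumes b: "b < n" and k: "n - Suc b = k" "k \<noteq> 0"
    and avoid: "\<And>l b'. l \<le> b \<Longrightarrow> b' < l \<Longrightarrow> y \<notin> obstacle l b'"
    and P: "in_class n k p\<^sub>1 p\<^sub>2 q" "near z p\<^sub>2 q" "\<bar>z - y\<bar> \<le> rho / R ^ b"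
    and P': "in_class n k p\<^sub>1' p\<^sub>2' q'" "near z' p\<^sub>2' q'" "\<bar>z' - y\<bar> \<le> rho / R ^ b"
    and L: "line A B C p\<^sub>1 p\<^sub>2 q" "B > 0" "real (slope p\<^sub>1 p\<^sub>2 q) = of_int B"
    and L': "line A' B' C' p\<^sub>1' p\<^sub>2' q'" "B' > 0" "real (slope p\<^sub>1' p\<^sub>2' q') = of_int B'"
    and qq': "q \<le> q'"
  shows "of_int B' * (of_int A * \<theta> + of_int C) = of_int B * (of_int A' * \<theta> + of_int C')"
proof -
  have cl: "close p\<^sub>1 q" "close p\<^sub>1' q'" using P P' by (auto simp: in_class_def)
  have q: "real q > 0" "real q' > 0" "real q \<le> real q'" using cl qq' by (auto simp: close_def)
  define s where "s = T ^ (k + \<kappa>)"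
  have s1: "1 \<le> s" using T_gt_1 by (simp add: s_def)
  have sj: "s powr j = R ^ (k + \<kappa>)" by (simp add: s_def T_power_powr_j)
  have R0: "R > 0" using R by simp
  \<comment> \<open>the choice of \<open>\<kappa>\<close>, scaled to the class\<close>
  have big: "16 * R ^ (k + 3) * T \<le> R ^ (k + \<kappa>)"
    using mult_left_mono[OF \<kappa>, of "R ^ k"] R0 by (simp add: T_def power_add mult_ac)
  have sR: "R ^ (k + \<kappa>) \<le> s" unfolding s_def using R R_le_T by (intro power_mono) auto
  have Bs: "of_int B * s \<le> real q powr j" "of_int B' * s \<le> real q' powr j"
    using P P' k L L' by (auto simp: in_class_def s_def mult.commute)
  have qj: "real q powr j \<le> real q' powr j" "real q powr i \<le> real q' powr i"
    using q ij by (auto intro!: powr_mono2)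
  have BQ: "of_int B \<le> real q' powr j / s" "of_int B' \<le> real q' powr j / s"
    using Bs qj s1 by (auto simp: pos_le_divide_eq)
  have AQ: "\<bar>real_of_int A\<bar> \<le> real q' powr i" "\<bar>real_of_int A'\<bar> \<le> real q' powr i"
    using L(1) L'(1) qj by (auto simp: line_def)
  have up: "real q' powr (1 + j) < R ^ n * (T * s)"
    using in_class_upper[OF P'(1)] by (simp add: s_def mult_ac)
  have "R ^ n * s \<le> R * (real q * of_int B) * s"
    using P(1) s1 L(3) by (intro mult_right_mono) (auto simp: in_class_def height_def)
  also have "\<dots> = R * real q * (of_int B * s)" by simp
  also have "\<dots> \<le> R * real q * real q powr j"
    using Bs(1) R0 q by (intro mult_left_mono) auto
  also have "\<dots> = R * real q powr (1 + j)" using q by (simp add: powr_1_j)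
  finally have lowq: "R ^ n * s \<le> R * real q powr (1 + j)" .
  have "real q' powr (1 + j) < T * (R ^ n * s)" using up by (simp only: mult_ac)
  also have "\<dots> \<le> T * (R * real q powr (1 + j))"
    using lowq T_gt_1 by (intro mult_left_mono) auto
  also have "\<dots> = (R * T) * real q powr (1 + j)" by (simp only: mult_ac)
  finally have ratio: "real q' < (R * T) * real q" by (rule le_of_powr_ratio[OF q(1,3)])
  define G where "G = 4 * c * R ^ (k + 3) * T / real q'"
  have Rn: "R ^ n = R ^ b * R ^ (k + 1)"
  proof -
    have "n = b + (k + 1)" using b k by simp
    then show ?thesis by (simp only: power_add)
  qed
  have form: "\<bar>of_int A * \<theta> + of_int B * y + of_int C\<bar> \<le> 4 * c * R ^ (k + 2) / real q"
    if "line A B C p\<^sub>1 p\<^sub>2 q" "B > 0" "real (slope p\<^sub>1 p\<^sub>2 q) = of_int B"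
       "in_class n k p\<^sub>1 p\<^sub>2 q" "near z p\<^sub>2 q" "\<bar>z - y\<bar> \<le> rho / R ^ b" for A B C p\<^sub>1 p\<^sub>2 q z
  proof -
    have q: "real q > 0" "close p\<^sub>1 q" using that by (auto simp: in_class_def close_def)
    have "real q * of_int B < R ^ n" using that by (simp add: in_class_def height_def)
    then have "of_int B \<le> R ^ n / real q" using q by (simp add: pos_le_divide_eq mult.commute)
    then have "of_int B * \<bar>z - y\<bar> \<le> R ^ n / real q * (rho / R ^ b)"
      using that R0 q by (intro mult_mono) auto
    also have "\<dots> = 2 * c * R ^ (k + 2) / real q"
      using R0 q by (simp add: Rn rho_def field_simps)
    finally have 1: "of_int B * \<bar>z - y\<bar> \<le> 2 * c * R ^ (k + 2) / real q" .
    have "\<bar>of_int A * \<theta> + of_int B * y + of_int C\<bar> =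
      \<bar>(of_int A * \<theta> + of_int B * z + of_int C) - of_int B * (z - y)\<bar>" by (simp add: algebra_simps)
    also have "\<dots> \<le> \<bar>of_int A * \<theta> + of_int B * z + of_int C\<bar> + of_int B * \<bar>z - y\<bar>"
      using abs_triangle_ineq4[of "of_int A * \<theta> + of_int B * z + of_int C" "of_int B * (z - y)"] that(2)
      by (simp add: abs_mult)
    also have "\<dots> \<le> 2 * c / real q + 2 * c * R ^ (k + 2) / real q"
      by (intro add_mono 1 line_form_bound[OF that(1) q(2) that(5)])
    also have "\<dots> \<le> 2 * c * R ^ (k + 2) / real q + 2 * c * R ^ (k + 2) / real q"
      using c q R one_le_power[of R "k + 2"] by (intro add_mono divide_right_mono) auto
    also have "\<dots> = 4 * c * R ^ (k + 2) / real q" by (simp add: field_simps)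
    finally show ?thesis .
  qed
  define f where "f = of_int A * \<theta> + of_int B * y + of_int C"
  define f' where "f' = of_int A' * \<theta> + of_int B' * y + of_int C'"
  have cR: "0 \<le> 4 * c * R ^ (k + 2)" using c R0 by simp
  have "\<bar>f\<bar> \<le> 4 * c * R ^ (k + 2) / real q" unfolding f_def by (rule form[OF L P])
  also have "\<dots> \<le> 4 * c * R ^ (k + 2) * (R * T / real q')"
  proof -
    have "1 / real q \<le> R * T / real q'" using ratio q by (simp add: field_simps)
    from mult_left_mono[OF this cR] show ?thesis by simp
  qed
  also have "\<dots> = G" by (simp add: G_def power_add power2_eq_square power3_eq_cube)
  finally have fG: "\<bar>f\<bar> \<le> G" .
  have "\<bar>f'\<bar> \<le> 4 * c * R ^ (k + 2) / real q'" unfolding f'_def by (rule form[OF L' P'])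
  also have "\<dots> \<le> 4 * c * R ^ (k + 2) * (R * T) / real q'"
  proof (rule divide_right_mono)
    have "1 * 1 \<le> R * T" using R T_gt_1 by (intro mult_mono) auto
    from mult_left_mono[OF this cR] show "4 * c * R ^ (k + 2) \<le> 4 * c * R ^ (k + 2) * (R * T)" by simp
  qed simp
  also have "\<dots> = G" by (simp add: G_def power_add power2_eq_square power3_eq_cube)
  finally have fG': "\<bar>f'\<bar> \<le> G" .
  \<comment> \<open>homogeneous coordinates \<open>(r1, r2, q0)\<close> of the point of intersection, with \<open>q0 = 0\<close> for parallel lines\<close>
  define q0 where "q0 = A * B' - A' * B"
  define r1 where "r1 = B * C' - B' * C"
  define r2 where "r2 = C * A' - C' * A"
  have x0: "of_int q0 * \<theta> - of_int r1 = of_int B' * f - of_int B * f'"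
    by (simp add: q0_def r1_def f_def f'_def algebra_simps)
  have y0: "of_int q0 * y - of_int r2 = of_int A * f' - of_int A' * f"
    by (simp add: q0_def r2_def f_def f'_def algebra_simps)
  have tri: "\<bar>a * b - a' * b'\<bar> \<le> 2 * (M * N)"
    if "\<bar>a\<bar> \<le> M" "\<bar>a'\<bar> \<le> M" "\<bar>b\<bar> \<le> N" "\<bar>b'\<bar> \<le> N" for a b a' b' M N :: real
  proof -
    have "0 \<le> M" using that(1) by linarith
    have "\<bar>a * b - a' * b'\<bar> \<le> \<bar>a\<bar> * \<bar>b\<bar> + \<bar>a'\<bar> * \<bar>b'\<bar>" by (metis abs_mult abs_triangle_ineq4)
    also have "\<dots> \<le> M * N + M * N" using that \<open>0 \<le> M\<close> by (intro add_mono mult_mono) auto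
    finally show ?thesis by simp
  qed
  have aB: "\<bar>real_of_int B\<bar> \<le> real q' powr j / s" "\<bar>real_of_int B'\<bar> \<le> real q' powr j / s"
    using BQ L(2) L'(2) by auto
  have "\<bar>real_of_int q0\<bar> = \<bar>of_int A * of_int B' - of_int A' * of_int B\<bar>" by (simp add: q0_def)
  also have "\<dots> \<le> 2 * (real q' powr i * (real q' powr j / s))" by (rule tri) (use AQ aB in auto)
  also have "\<dots> = 2 * real q' / s" using powr_i_j[of "real q'"] q by (simp add: mult.assoc[symmetric])
  finally have Q0: "\<bar>real_of_int q0\<bar> \<le> 2 * real q' / s" .
  have "\<bar>of_int q0 * \<theta> - of_int r1\<bar> \<le> 2 * (real q' powr j / s * G)"
    unfolding x0 by (rule tri) (use aB fG fG' in auto)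
  also have "\<dots> = 8 * c * R ^ (k + 3) * T / s * (real q' powr j / real q')" by (simp add: G_def)
  also have "real q' powr j / real q' = real q' powr (- i)"
    using powr_i_j[of "real q'"] q by (simp add: powr_minus field_simps)
  finally have X0: "\<bar>of_int q0 * \<theta> - of_int r1\<bar> \<le> 8 * c * R ^ (k + 3) * T / s * real q' powr (- i)" .
  have "\<bar>of_int q0 * y - of_int r2\<bar> \<le> 2 * (real q' powr i * G)"
    unfolding y0 by (rule tri) (use AQ fG fG' in auto)
  also have "\<dots> = 8 * c * R ^ (k + 3) * T * (real q' powr i / real q')" by (simp add: G_def)
  also have "real q' powr i / real q' = real q' powr (- j)"
    using powr_i_j[of "real q'"] q by (simp add: powr_minus field_simps)
  finally have Y0: "\<bar>of_int q0 * y - of_int r2\<bar> \<le> 8 * c * R ^ (k + 3) * T * real q' powr (- j)" .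
  have half: "8 * c * R ^ (k + 3) * T / s \<le> c / 2" "8 * c * R ^ (k + 3) * T / s powr j \<le> c / 2"
    using mult_left_mono[OF big, of c] mult_left_mono[OF order.trans[OF big sR], of c] c R0 s1
    by (auto simp: sj pos_divide_le_eq)
  have "q0 = 0"
  proof (rule ccontr)
    assume "q0 \<noteq> 0"
    \<comment> \<open>the sign \<open>e\<close> makes the denominator \<open>m\<close> positive\<close>
    define m where "m = nat \<bar>q0\<bar>"
    have m: "m \<ge> 1" "real m = \<bar>real_of_int q0\<bar>" using \<open>q0 \<noteq> 0\<close> by (auto simp: m_def)
    define e where "e = (if q0 > 0 then 1 else - 1 :: int)"
    have e: "real m = of_int e * of_int q0" "\<bar>real_of_int e\<bar> = 1" using \<open>q0 \<noteq> 0\<close> by (auto simp: m(2) e_def)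
    have flip: "\<bar>real m * x - of_int (e * r)\<bar> = \<bar>of_int q0 * x - of_int r\<bar>" for x r
    proof -
      have "real m * x - of_int (e * r) = of_int e * (of_int q0 * x - of_int r)"
        by (simp add: e(1) algebra_simps)
      then show ?thesis by (simp add: abs_mult e(2))
    qed
    have mle: "real m \<le> 2 * real q' / s" using Q0 m by simp
    have pow: "real m powr w \<le> 2 * (real q' powr w / s powr w)" if w: "0 < w" "w < 1" for w
    proof -
      have "real m powr w \<le> (2 * real q' / s) powr w" using mle w by (intro powr_mono2) auto
      also have "\<dots> = 2 powr w * (real q' powr w / s powr w)"
        using q s1 by (simp add: powr_mult powr_divide)
      also have "\<dots> \<le> 2 * (real q' powr w / s powr w)"
      proof (rule mult_right_mono)
        have "2 powr w \<le> 2 powr (1::real)" using w by (intro powr_mono) auto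
        then show "2 powr w \<le> (2::real)" by simp
      qed simp
      finally show ?thesis .
    qed
    have ij1: "i < 1" "j < 1" using ij by auto
    have "close (e * r1) m"
    proof -
      have "\<bar>real m * \<theta> - of_int (e * r1)\<bar> * real m powr i \<le>
        (8 * c * R ^ (k + 3) * T / s * real q' powr (- i)) * (2 * (real q' powr i / s powr i))"
        unfolding flip using X0 pow[of i] ij ij1 c R0 s1 T_gt_1 by (intro mult_mono) auto
      also have "\<dots> = 2 * (8 * c * R ^ (k + 3) * T / s) / s powr i" using q by (simp add: powr_minus)
      also have "\<dots> \<le> 2 * (c / 2) / 1"
      proof (rule frac_le)
        show "2 * (8 * c * R ^ (k + 3) * T / s) \<le> 2 * (c / 2)" using half(1) by (intro mult_left_mono) auto
      qed (use c s1 ij in \<open>auto simp: ge_one_powr_ge_zero\<close>)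
      finally show ?thesis using m by (simp add: close_def powr_minus field_simps)
    qed
    moreover have "near y (e * r2) m"
    proof -
      have "\<bar>real m * y - of_int (e * r2)\<bar> * real m powr j \<le>
        (8 * c * R ^ (k + 3) * T * real q' powr (- j)) * (2 * (real q' powr j / s powr j))"
        unfolding flip using Y0 pow[of j] ij ij1 c R0 s1 T_gt_1 by (intro mult_mono) auto
      also have "\<dots> = 2 * (8 * c * R ^ (k + 3) * T / s powr j)" using q by (simp add: powr_minus)
      also have "\<dots> \<le> c" using half by simp
      finally show ?thesis using m by (simp add: near_def powr_minus field_simps)
    qed
    moreover have "height (e * r1) (e * r2) m < R ^ b"
    proof -
      have "height (e * r1) (e * r2) m \<le> real m * real m powr j"
        unfolding height_def using slope_bounds(2)[OF calculation(1)] by (intro mult_left_mono) auto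
      also have "\<dots> \<le> 2 * real q' / s * (2 * (real q' powr j / s powr j))"
        using mle pow[of j] ij ij1 q s1 by (intro mult_mono) auto
      also have "\<dots> = 4 * real q' powr (1 + j) / (s * s powr j)"
        using q by (simp add: powr_1_j)
      also have "\<dots> < 4 * (R ^ n * (T * s)) / (s * s powr j)"
        using up s1 by (intro divide_strict_right_mono) auto
      also have "\<dots> = 4 * R ^ n * T / R ^ (k + \<kappa>)" using s1 by (simp add: sj)
      also have "\<dots> \<le> R ^ b"
      proof -
        have "4 * R ^ (k + 1) * T \<le> 16 * R ^ (k + 3) * T"
          using R T_gt_1 by (intro mult_right_mono mult_mono power_increasing) auto
        also note big
        finally have "R ^ b * (4 * R ^ (k + 1) * T) \<le> R ^ b * R ^ (k + \<kappa>)"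
          using R0 by (intro mult_left_mono) auto
        then show ?thesis using R0 by (simp add: Rn pos_divide_le_eq mult_ac)
      qed
      finally show ?thesis .
    qed
    ultimately show False using in_some_obstacle[of "e * r1" m y "e * r2" b] avoid by blast
  qed
  moreover have "r1 = 0"
  proof -
    have "\<bar>real_of_int r1\<bar> \<le> 8 * c * R ^ (k + 3) * T / s * real q' powr (- i)"
      using X0 \<open>q0 = 0\<close> by simp
    also have "\<dots> \<le> c / 2 * 1"
    proof (rule mult_mono)
      have "real q' powr (- i) \<le> real q' powr 0" using ij cl by (intro powr_mono) (auto simp: close_def)
      then show "real q' powr (- i) \<le> 1" using q by simp
    qed (use half c in auto)
    also have "\<dots> < 1"
    proof -
      have "1 * c \<le> (6 * R * (R * T ^ (\<kappa> + 1))\<^sup>2) * c"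
      proof (rule mult_right_mono)
        have "1 * 1 \<le> R * T ^ (\<kappa> + 1)" using R T_gt_1 by (intro mult_mono one_le_power) auto
        then have "1 \<le> (R * T ^ (\<kappa> + 1))\<^sup>2" by (simp add: one_le_power)
        then have "1 * 1 \<le> (6 * R) * (R * T ^ (\<kappa> + 1))\<^sup>2" using R by (intro mult_mono) auto
        then show "1 \<le> 6 * R * (R * T ^ (\<kappa> + 1))\<^sup>2" by simp
      qed (use c in simp)
      then show ?thesis using c(3) by (simp add: T_def[symmetric] mult_ac)
    qed
    finally show ?thesis by linarith
  qed
  ultimately have "of_int B' * f - of_int B * f' = 0" using x0 by simp
  then show ?thesis by (simp add: f_def f'_def algebra_simps)
qed

text \<open>
  The line through two different points has small coefficients, and its \<open>B\<close> is so small
  compared with \<open>q powr j\<close> that the minimality of the slope is violated.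
\<close>
lemma points_on_horizontal_line:
  assumes k: "n = Suc b"
    and P: "in_class n 0 p\<^sub>1 p\<^sub>2 q" "near z p\<^sub>2 q" "\<bar>z - y\<bar> \<le> rho / R ^ b"
    and P': "in_class n 0 p\<^sub>1' p\<^sub>2' q'" "near z' p\<^sub>2' q'" "\<bar>z' - y\<bar> \<le> rho / R ^ b"
    and qq': "q \<le> q'"
  shows "of_int p\<^sub>2 / real q = of_int p\<^sub>2' / real q'"
proof -
  have cl: "close p\<^sub>1 q" "close p\<^sub>1' q'" using P P' by (auto simp: in_class_def)
  have q: "real q > 0" "real q' > 0" "real q \<le> real q'" using cl qq' by (auto simp: close_def)
  have R0: "R > 0" using R by simp
  define E where "E = R * T ^ Suc \<kappa>"
  have E1: "1 \<le> E"
  proof -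
    have "1 * 1 \<le> R * T ^ Suc \<kappa>" using R T_gt_1 by (intro mult_mono one_le_power) auto
    then show ?thesis by (simp add: E_def)
  qed
  have small: "6 * c * R * E\<^sup>2 \<le> 1" using c(3) by (simp add: E_def T_def)
  have "R ^ n \<le> R * (real q * real (slope p\<^sub>1 p\<^sub>2 q))" using P(1) by (simp add: in_class_def height_def)
  also have "\<dots> \<le> R * (real q * real q powr j)"
    using slope_bounds(2)[OF cl(1)] R0 by (intro mult_left_mono) auto
  finally have low: "R ^ n \<le> R * real q powr (1 + j)" using q by (simp add: powr_1_j)
  have up: "real q powr (1 + j) < R ^ n * T ^ Suc \<kappa>" "real q' powr (1 + j) < R ^ n * T ^ Suc \<kappa>"
    using in_class_upper[OF P(1)] in_class_upper[OF P'(1)] by simp_all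
  have "real q' powr (1 + j) < (R * real q powr (1 + j)) * T ^ Suc \<kappa>"
    by (rule less_le_trans[OF up(2)]) (use low T_gt_1 in \<open>intro mult_right_mono, auto\<close>)
  then have "real q' powr (1 + j) < E * real q powr (1 + j)" by (simp only: E_def mult_ac)
  then have ratio: "real q' < E * real q" by (rule le_of_powr_ratio[OF q(1,3)])
  \<comment> \<open>the line through the two points; \<open>A = 0\<close> is the claim\<close>
  define A where "A = p\<^sub>2 * int q' - p\<^sub>2' * int q"
  define B where "B = int q * p\<^sub>1' - int q' * p\<^sub>1"
  define C where "C = p\<^sub>1 * p\<^sub>2' - p\<^sub>2 * p\<^sub>1'"
  have on: "A * p\<^sub>1 + B * p\<^sub>2 + C * int q = 0" by (simp add: A_def B_def C_def algebra_simps)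
  have decr: "real q' powr (- i) \<le> real q powr (- i)" "real q' powr (- j) \<le> real q powr (- j)"
    using q ij by (auto intro!: powr_mono2')
  have Bb: "\<bar>real_of_int B\<bar> \<le> 2 * c * E * real q powr j"
  proof -
    have "real_of_int B = real q' * (real q * \<theta> - of_int p\<^sub>1) - real q * (real q' * \<theta> - of_int p\<^sub>1')"
      by (simp add: B_def algebra_simps)
    also have "\<bar>\<dots>\<bar> \<le> real q' * \<bar>real q * \<theta> - of_int p\<^sub>1\<bar> + real q * \<bar>real q' * \<theta> - of_int p\<^sub>1'\<bar>"
      using q by (metis abs_mult abs_of_pos abs_triangle_ineq4)
    also have "\<dots> \<le> real q' * (c * real q powr (- i)) + real q' * (c * real q powr (- i))"
    proof (intro add_mono mult_mono)
      show "\<bar>real q' * \<theta> - of_int p\<^sub>1'\<bar> \<le> c * real q powr (- i)"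
        by (rule order.trans[OF _ mult_left_mono[OF decr(1)]]) (use cl(2) c in \<open>auto simp: close_def\<close>)
    qed (use cl q c in \<open>auto simp: close_def\<close>)
    also have "\<dots> = 2 * c * real q powr (- i) * real q'" by simp
    also have "\<dots> \<le> 2 * c * real q powr (- i) * (E * real q)"
      using ratio c by (intro mult_left_mono) auto
    also have "\<dots> = 2 * c * E * (real q powr (- i) * real q)" by simp
    also have "real q powr (- i) * real q = real q powr j"
      using powr_i_j[of "real q"] q by (simp add: powr_minus field_simps)
    finally show ?thesis .
  qed
  have Ab: "\<bar>real_of_int A\<bar> \<le> real q powr i"
  proof -
    define \<epsilon> where "\<epsilon> = rho / R ^ b"
    have "0 \<le> \<epsilon>" using P(3) unfolding \<epsilon>_def by linarith
    have dy: "\<bar>real r * y - of_int p\<bar> \<le> c * real r powr (- j) + real r * \<epsilon>"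
      if "near x p r" "\<bar>x - y\<bar> \<le> \<epsilon>" for x p r
    proof -
      have "real r * y - of_int p = (real r * x - of_int p) - real r * (x - y)" by (simp add: algebra_simps)
      also have "\<bar>\<dots>\<bar> \<le> \<bar>real r * x - of_int p\<bar> + real r * \<bar>x - y\<bar>"
        by (metis abs_mult abs_of_nat abs_triangle_ineq4)
      also have "\<dots> \<le> c * real r powr (- j) + real r * \<epsilon>"
        using that by (intro add_mono mult_left_mono) (auto simp: near_def)
      finally show ?thesis .
    qed
    have "real_of_int A = real q * (real q' * y - of_int p\<^sub>2') - real q' * (real q * y - of_int p\<^sub>2)"
      by (simp add: A_def algebra_simps)
    also have "\<bar>\<dots>\<bar> \<le> real q * \<bar>real q' * y - of_int p\<^sub>2'\<bar> + real q' * \<bar>real q * y - of_int p\<^sub>2\<bar>"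
      using q by (metis abs_mult abs_of_pos abs_triangle_ineq4)
    also have "\<dots> \<le> real q * (c * real q' powr (- j) + real q' * \<epsilon>) + real q' * (c * real q powr (- j) + real q * \<epsilon>)"
      using dy[OF P(2)] dy[OF P'(2)] P(3) P'(3) by (intro add_mono mult_left_mono) (auto simp: \<epsilon>_def)
    also have "\<dots> \<le> real q' * (c * real q powr (- j)) + real q * real q' * \<epsilon> + (real q' * (c * real q powr (- j)) + real q * real q' * \<epsilon>)"
    proof -
      have "real q * (c * real q' powr (- j)) \<le> real q' * (c * real q powr (- j))"
        using q c decr by (intro mult_mono mult_left_mono) auto
      then show ?thesis by (simp add: algebra_simps)
    qed
    also have "\<dots> = real q' * (2 * c * real q powr (- j) + 2 * real q * \<epsilon>)" by (simp add: algebra_simps)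
    also have "\<dots> \<le> (E * real q) * (2 * c * real q powr (- j) + 2 * real q * \<epsilon>)"
      using ratio q c \<open>0 \<le> \<epsilon>\<close> by (intro mult_right_mono) auto
    also have "\<dots> = 2 * c * E * (real q powr (- j) * real q) + 2 * E * (real q * real q * \<epsilon>)"
      by (simp add: algebra_simps)
    also have "real q powr (- j) * real q = real q powr i"
      using powr_i_j[of "real q"] q by (simp add: powr_minus field_simps)
    also have "real q * real q * \<epsilon> \<le> 2 * c * R * E * real q powr i"
    proof -
      have "real q * real q = real q powr (1 + j) * real q powr i"
        using powr_i_j[of "real q"] q by (simp add: powr_1_j mult_ac)
      also have "\<dots> \<le> (R ^ n * T ^ Suc \<kappa>) * real q powr i"
        using up by (intro mult_right_mono) auto
      finally have "real q * real q * \<epsilon> \<le> (R ^ n * T ^ Suc \<kappa>) * real q powr i * \<epsilon>"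
        using \<open>0 \<le> \<epsilon>\<close> by (rule mult_right_mono)
      also have "\<dots> = 2 * c * R * E * real q powr i" using R0 by (simp add: \<epsilon>_def rho_def E_def k)
      finally show ?thesis .
    qed
    then have "2 * c * E * real q powr i + 2 * E * (real q * real q * \<epsilon>) \<le>
      2 * c * E * real q powr i + 2 * E * (2 * c * R * E * real q powr i)"
      using E1 by (intro add_left_mono mult_left_mono) auto
    also have "\<dots> \<le> 2 * c * (R * E * E) * real q powr i + 2 * E * (2 * c * R * E * real q powr i)"
    proof -
      have "1 * E \<le> (R * E) * E"
      proof (rule mult_right_mono)
        have "1 * 1 \<le> R * E" using R E1 by (intro mult_mono) auto
        then show "1 \<le> R * E" by simp
      qed (use E1 in simp)
      then show ?thesis using c by (intro add_right_mono mult_right_mono mult_left_mono) auto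
    qed
    also have "\<dots> = 6 * c * R * E\<^sup>2 * real q powr i" by (simp add: power2_eq_square algebra_simps)
    also have "\<dots> \<le> 1 * real q powr i" using small by (intro mult_right_mono) auto
    finally show ?thesis by simp
  qed
  have "A = 0"
  proof (rule ccontr)
    assume "A \<noteq> 0"
    have EE: "E \<le> R * E\<^sup>2" "E * T ^ Suc \<kappa> \<le> R * E\<^sup>2"
    proof -
      have "E * 1 \<le> E * (R * E)" using R E1 mult_mono[of 1 R 1 E] by (intro mult_left_mono) auto
      then show "E \<le> R * E\<^sup>2" by (simp add: power2_eq_square mult_ac)
      have "T ^ Suc \<kappa> \<le> E" using R T_gt_1 mult_right_mono[of 1 R "T ^ Suc \<kappa>"] by (simp add: E_def)
      also have "E \<le> R * E" using R E1 mult_right_mono[of 1 R E] by simp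
      finally have "E * T ^ Suc \<kappa> \<le> E * (R * E)" using E1 by (intro mult_left_mono) auto
      then show "E * T ^ Suc \<kappa> \<le> R * E\<^sup>2" by (simp add: power2_eq_square mult_ac)
    qed
    have "2 * c * E \<le> 6 * c * (R * E\<^sup>2)" using EE(1) c E1 by (intro mult_mono) auto
    then have "2 * c * E \<le> 1" using small by (simp add: mult_ac)
    then have "\<bar>real_of_int B\<bar> \<le> 1 * real q powr j"
      by (intro order.trans[OF Bb] mult_right_mono) auto
    then have "line A B C p\<^sub>1 p\<^sub>2 q" using on Ab \<open>A \<noteq> 0\<close> by (simp add: line_def)
    then have "slope p\<^sub>1 p\<^sub>2 q \<le> nat \<bar>B\<bar>" by (rule slope_le)
    then have "real (slope p\<^sub>1 p\<^sub>2 q) \<le> \<bar>real_of_int B\<bar>" by linarith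
    also note Bb
    also have "2 * c * E * real q powr j \<le> 2 * c * E * (T ^ Suc \<kappa> * real (slope p\<^sub>1 p\<^sub>2 q))"
      using P(1) c E1 by (intro mult_left_mono) (auto simp: in_class_def)
    also have "\<dots> = 2 * c * (E * T ^ Suc \<kappa>) * real (slope p\<^sub>1 p\<^sub>2 q)" by simp
    also have "\<dots> \<le> 2 * c * (R * E\<^sup>2) * real (slope p\<^sub>1 p\<^sub>2 q)"
      using EE(2) c by (intro mult_right_mono mult_left_mono) auto
    also have "\<dots> \<le> 1 / 3 * real (slope p\<^sub>1 p\<^sub>2 q)"
      using small by (intro mult_right_mono) auto
    finally show False using slope_bounds(1)[OF cl(1), of p\<^sub>2] by simp
  qed
  then have "real_of_int p\<^sub>2 * real q' = real_of_int p\<^sub>2' * real q"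
    by (simp add: A_def) (metis of_int_mult of_int_of_nat_eq)
  then show ?thesis using q by (simp add: field_simps)
qed

text \<open>
  For \<open>k = 0\<close> all dangerous points have the same second coordinate, and for \<open>k > 0\<close> all their
  lines cross the fibre at the same place. This place is the centre of the ball.
\<close>
lemma obstacle_confined:
  assumes b: "b < n" and avoid: "\<And>l b'. l \<le> b \<Longrightarrow> b' < l \<Longrightarrow> obstacle l b' \<inter> cball y (rho / R ^ b) = {}"
  shows "\<exists>d. obstacle n b \<inter> cball y (rho / R ^ b) \<subseteq> cball d (rho / R ^ n)"
proof (cases "obstacle n b \<inter> cball y (rho / R ^ b) = {}")
  case False
  have R0: "R > 0" using R by simp
  have y: "y \<notin> obstacle l b'" if "l \<le> b" "b' < l" for l b'
    using avoid[OF that] c R0 by (auto simp: rho_def)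
  define hit where "hit p\<^sub>1 p\<^sub>2 q z \<longleftrightarrow>
    in_class n (n - Suc b) p\<^sub>1 p\<^sub>2 q \<and> near z p\<^sub>2 q \<and> \<bar>z - y\<bar> \<le> rho / R ^ b" for p\<^sub>1 p\<^sub>2 q z
  have every: "\<exists>p\<^sub>1 p\<^sub>2 q. hit p\<^sub>1 p\<^sub>2 q z" if "z \<in> obstacle n b \<inter> cball y (rho / R ^ b)" for z
    using that by (auto simp: obstacle_def hit_def dist_real_def abs_minus_commute)
  obtain p\<^sub>1 p\<^sub>2 q z where h: "hit p\<^sub>1 p\<^sub>2 q z" using False every by blast
  have cl: "close p\<^sub>1 q" "real q > 0" "R ^ n \<le> R * height p\<^sub>1 p\<^sub>2 q" if "hit p\<^sub>1 p\<^sub>2 q z" for p\<^sub>1 p\<^sub>2 q z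
    using that by (auto simp: hit_def in_class_def close_def)
  show ?thesis
  proof (cases "n - Suc b = 0")
    case True
    then have nb: "n = Suc b" using b by simp
    show ?thesis
    proof (intro exI[of _ "of_int p\<^sub>2 / real q"] subsetI)
      fix z' assume "z' \<in> obstacle n b \<inter> cball y (rho / R ^ b)"
      then obtain p\<^sub>1' p\<^sub>2' q' where h': "hit p\<^sub>1' p\<^sub>2' q' z'" using every by blast
      have eq: "of_int p\<^sub>2 / real q = of_int p\<^sub>2' / real q'"
      proof (cases "q \<le> q'")
        case True
        then show ?thesis
          using points_on_horizontal_line[OF nb, of p\<^sub>1 p\<^sub>2 q z y p\<^sub>1' p\<^sub>2' q' z'] h h'
          by (simp add: hit_def nb)
      next
        case False
        then show ?thesis
          using points_on_horizontal_line[OF nb, of p\<^sub>1' p\<^sub>2' q' z' y p\<^sub>1 p\<^sub>2 q z] h h'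
          by (simp add: hit_def nb)
      qed
      note cl' = cl[OF h']
      have "R ^ n \<le> R * (real q' * real q' powr j)"
      proof (rule order.trans[OF cl'(3)])
        show "R * height p\<^sub>1' p\<^sub>2' q' \<le> R * (real q' * real q' powr j)"
          unfolding height_def using slope_bounds(2)[OF cl'(1)] R0 by (intro mult_left_mono) auto
      qed
      then have "R ^ n * real q' powr (- j) \<le> R * real q'"
        using cl'(2) by (simp add: powr_minus field_simps)
      then have "real q' powr (- j) \<le> R * real q' / R ^ n" using R0 by (simp add: pos_le_divide_eq mult.commute)
      then have "c * real q' powr (- j) \<le> c * (R * real q' / R ^ n)" using c by (intro mult_left_mono) auto
      then have "\<bar>real q' * z' - of_int p\<^sub>2'\<bar> \<le> c * (R * real q' / R ^ n)"
        using h' by (simp add: hit_def near_def)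
      also have "\<dots> \<le> real q' * (rho / R ^ n)" using c R0 by (simp add: rho_def field_simps)
      finally have "\<bar>real q' * z' - of_int p\<^sub>2'\<bar> \<le> real q' * (rho / R ^ n)" .
      then have "real q' * \<bar>z' - of_int p\<^sub>2' / real q'\<bar> \<le> real q' * (rho / R ^ n)"
        
      proof -
        have "real q' * z' - of_int p\<^sub>2' = real q' * (z' - of_int p\<^sub>2' / real q')"
          using cl'(2) by (simp add: right_diff_distrib)
        then have "\<bar>real q' * z' - of_int p\<^sub>2'\<bar> = real q' * \<bar>z' - of_int p\<^sub>2' / real q'\<bar>"
          by (metis abs_mult abs_of_nat)
        then show ?thesis using \<open>\<bar>real q' * z' - of_int p\<^sub>2'\<bar> \<le> real q' * (rho / R ^ n)\<close> by simp
      qed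
      then have "\<bar>z' - of_int p\<^sub>2' / real q'\<bar> \<le> rho / R ^ n" by (simp only: mult_le_cancel_left_pos[OF cl'(2)])
      then show "z' \<in> cball (of_int p\<^sub>2 / real q) (rho / R ^ n)"
        by (simp add: eq dist_real_def abs_minus_commute)
    qed
  next
    case k: False
    obtain A B C where L: "line A B C p\<^sub>1 p\<^sub>2 q" "B > 0" "real (slope p\<^sub>1 p\<^sub>2 q) = of_int B"
      using slope_attained[OF cl(1)[OF h]] .
    show ?thesis
    proof (intro exI[of _ "- (of_int A * \<theta> + of_int C) / of_int B"] subsetI)
      fix z' assume "z' \<in> obstacle n b \<inter> cball y (rho / R ^ b)"
      then obtain p\<^sub>1' p\<^sub>2' q' where h': "hit p\<^sub>1' p\<^sub>2' q' z'" using every by blast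
      note cl' = cl[OF h']
      obtain A' B' C' where L': "line A' B' C' p\<^sub>1' p\<^sub>2' q'" "B' > 0" "real (slope p\<^sub>1' p\<^sub>2' q') = of_int B'"
        using slope_attained[OF cl'(1)] .
      have eq: "of_int B' * (of_int A * \<theta> + of_int C) = of_int B * (of_int A' * \<theta> + of_int C')"
      proof (cases "q \<le> q'")
        case True
        then show ?thesis
          using lines_meet_on_fibre[OF b refl k y, of p\<^sub>1 p\<^sub>2 q z p\<^sub>1' p\<^sub>2' q' z' A B C A' B' C'] h h' L L'
          by (simp add: hit_def)
      next
        case False
        then show ?thesis
          using lines_meet_on_fibre[OF b refl k y, of p\<^sub>1' p\<^sub>2' q' z' p\<^sub>1 p\<^sub>2 q z A' B' C' A B C] h h' L L'
          by (simp add: hit_def)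
      qed
      then have eq': "- (of_int A * \<theta> + of_int C) / of_int B = - (of_int A' * \<theta> + of_int C') / of_int B'"
        using L(2) L'(2) by (simp add: field_simps)
      have B': "0 < real_of_int B'" using L'(2) by simp
      have "real q' * of_int B' * (rho / R ^ n) \<ge> R ^ n / R * (rho / R ^ n)"
        using cl'(3) R0 c by (intro mult_right_mono) (auto simp: height_def L'(3) rho_def field_simps)
      then have "2 * c \<le> real q' * of_int B' * (rho / R ^ n)" using R0 by (simp add: rho_def)
      then have "2 * c / real q' \<le> of_int B' * (rho / R ^ n)" using cl'(2) by (simp add: pos_divide_le_eq mult_ac)
      then have "\<bar>of_int A' * \<theta> + of_int B' * z' + of_int C'\<bar> \<le> of_int B' * (rho / R ^ n)"
        using line_form_bound[OF L'(1) cl'(1)] h' by (auto simp: hit_def intro: order.trans)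
      also have "of_int A' * \<theta> + of_int B' * z' + of_int C' =
        of_int B' * (z' - (- (of_int A' * \<theta> + of_int C') / of_int B'))"
        using B' by (simp add: field_simps)
      finally have "of_int B' * \<bar>z' - (- (of_int A' * \<theta> + of_int C') / of_int B')\<bar> \<le> of_int B' * (rho / R ^ n)"
        using B' by (simp add: abs_mult)
      then have "\<bar>z' - (- (of_int A' * \<theta> + of_int C') / of_int B')\<bar> \<le> rho / R ^ n"
        using B' by (simp only: mult_le_cancel_left_pos)
      then show "z' \<in> cball (- (of_int A * \<theta> + of_int C) / of_int B) (rho / R ^ n)"
        unfolding eq' by (simp add: dist_real_def abs_minus_commute)
    qed
  qed
qed auto

lemma avoiding_obstacles_imp_Bad:
  assumes "\<And>n b. b < n \<Longrightarrow> y \<notin> obstacle n b"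
  shows "(\<theta>, y) \<in> Bad i j"
proof -
  define c' where "c' = min (c powr (1 / i)) (c powr (1 / j)) / 2"
  have c': "0 < c'" "c' < c powr (1 / i)" "c' < c powr (1 / j)" 
  proof -
    define x y where "x = c powr (1 / i)" and "y = c powr (1 / j)"
    have "x > 0" "y > 0" using c by (auto simp: x_def y_def)
    then show "0 < c'" "c' < c powr (1 / i)" "c' < c powr (1 / j)"
      unfolding c'_def x_def[symmetric] y_def[symmetric] by linarith+
  qed
  have "max (real q * \<bar>real q * \<theta> - of_int p\<^sub>1\<bar> powr (1 / i))
            (real q * \<bar>real q * y - of_int p\<^sub>2\<bar> powr (1 / j)) > c'" if q: "q \<ge> 1" for p\<^sub>1 p\<^sub>2 :: int and q :: nat
  proof -
    have "\<not> (close p\<^sub>1 q \<and> near y p\<^sub>2 q)"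
    proof
      assume *: "close p\<^sub>1 q \<and> near y p\<^sub>2 q"
      obtain m where "height p\<^sub>1 p\<^sub>2 q < R ^ m" using real_arch_pow[of R] R by auto
      then show False using in_some_obstacle[of p\<^sub>1 q y p\<^sub>2 m] * assms by blast
    qed
    moreover have big: "c powr (1 / w) < real q * x powr (1 / w)"
      if "0 < w" "c * real q powr (- w) < x" for w x :: real
    proof -
      have "(c * real q powr (- w)) powr (1 / w) < x powr (1 / w)"
        using that c q by (intro powr_less_mono2) auto
      moreover have "(c * real q powr (- w)) powr (1 / w) = c powr (1 / w) / real q"
        using that c q by (simp add: powr_mult powr_powr powr_minus_divide powr_divide)
      ultimately show ?thesis using q by (simp add: divide_less_eq mult.commute)
    qed
    ultimately consider "c powr (1 / i) < real q * \<bar>real q * \<theta> - of_int p\<^sub>1\<bar> powr (1 / i)"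
      | "c powr (1 / j) < real q * \<bar>real q * y - of_int p\<^sub>2\<bar> powr (1 / j)"
      using q ij by (auto simp: close_def near_def not_le)
    then show ?thesis using c' by cases auto
  qed
  then show ?thesis using c'(1) ij by (auto simp: Bad_def)
qed

lemma rho_bounds: "0 < rho" "rho < 1"
proof -
  show "0 < rho" using c R by (simp add: rho_def)
  have "1 * 1 \<le> R * T ^ (\<kappa> + 1)" using R T_gt_1 by (intro mult_mono one_le_power) auto
  then have "1 \<le> (R * T ^ (\<kappa> + 1))\<^sup>2" by (simp add: one_le_power)
  then have "(6 * c * R) * 1 \<le> (6 * c * R) * (R * T ^ (\<kappa> + 1))\<^sup>2" using c R by (intro mult_left_mono) auto
  then have "6 * c * R \<le> 1" using c(3) by (simp add: T_def)
  then show "rho < 1" using c R by (simp add: rho_def)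
qed

end

section \<open>Obstacles for the three kinds of weights\<close>

lemma weighted_obstacles:
  assumes ij: "0 < i" "0 < j" "i + j = 1" and \<theta>: "\<theta> \<in> Bad1 i" and R: "16 \<le> R"
  shows "\<exists>\<rho> W. 0 < \<rho> \<and> \<rho> < 1 \<and> scattered R \<rho> W \<and>
    (\<forall>y. (\<forall>n. \<forall>b<n. y \<notin> W n b) \<longrightarrow> (\<theta>, y) \<in> Bad i j)"
proof -
  obtain c0 where c0: "c0 > 0" "\<And>(p::int) (q::nat). q \<ge> 1 \<Longrightarrow> c0 < real q powr (1 / i) * \<bar>real q * \<theta> - of_int p\<bar>"
    using \<theta> ij by (auto simp: Bad1_def)
  \<comment> \<open>\<open>R ^ 3 * T\<close> has the exponent \<open>3 + 1 / j\<close>, and one more power of \<open>R\<close> absorbs the factor \<open>16\<close>\<close>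
  define \<kappa> where "\<kappa> = nat \<lceil>1 / j\<rceil> + 4"
  define K where "K = 6 * R * (R * (R powr (1 / j)) ^ (\<kappa> + 1))\<^sup>2"
  have K: "K > 0" using R by (auto simp: K_def)
  define c where "c = min c0 (1 / K)"
  have c: "0 < c" "c \<le> c0" "c \<le> 1 / K" using c0 K by (auto simp: c_def)
  have kap: "16 * R ^ 3 * R powr (1 / j) \<le> R ^ \<kappa>"
  proof -
    have "16 * R ^ 3 * R powr (1 / j) \<le> R * R ^ 3 * R powr real (nat \<lceil>1 / j\<rceil>)"
      using R by (intro mult_mono powr_mono) (auto intro: real_nat_ceiling_ge)
    also have "\<dots> = R ^ \<kappa>" using R by (simp add: \<kappa>_def powr_realpow power_add power4_eq_xxxx power3_eq_cube)
    finally show ?thesis .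
  qed
  interpret weighted_approximation i j \<theta> c0 c R \<kappa>
  proof
    have "c * K \<le> 1" using c K by (simp add: pos_le_divide_eq)
    then show "6 * c * R * (R * (R powr (1 / j)) ^ (\<kappa> + 1))\<^sup>2 \<le> 1" by (simp add: K_def mult_ac)
  qed (use ij c0 c R kap in auto)
  show ?thesis
  proof (rule exI[of _ rho], rule exI[of _ obstacle], intro conjI allI impI)
    show "0 < rho" "rho < 1" by (rule rho_bounds)+
    show "scattered R rho obstacle" by (simp add: scattered_def obstacle_confined)
    show "(\<theta>, y) \<in> Bad i j" if "\<forall>n. \<forall>b<n. y \<notin> obstacle n b" for y
      by (rule avoiding_obstacles_imp_Bad) (use that in simp)
  qed
qed

text \<open>
  For the weight \<open>(0, 1)\<close> the points are the rational numbers, and two of them with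
  denominators below \<open>sqrt (R ^ n)\<close> are more than \<open>1 / R ^ n\<close> apart.
\<close>
lemma classical_obstacles:
  assumes R: "16 \<le> R"
  shows "\<exists>\<rho> W. 0 < \<rho> \<and> \<rho> < 1 \<and> scattered R \<rho> W \<and>
    (\<forall>y. (\<forall>n. \<forall>b<n. y \<notin> W n b) \<longrightarrow> y \<in> BA)"
proof -
  define \<rho> where "\<rho> = 1 / (8 * R)"
  define c where "c = \<rho> / R"
  define W where "W n b = {y. n = Suc b \<and> (\<exists>(p::int) (q::nat). q \<ge> 1 \<and> R ^ b \<le> (real q)\<^sup>2 \<and> (real q)\<^sup>2 < R ^ n \<and>
    real q * \<bar>real q * y - of_int p\<bar> \<le> c)}" for n b
  have R0: "R > 0" using R by simp
  have \<rho>: "0 < \<rho>" "\<rho> < 1" using R by (auto simp: \<rho>_def)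
  have c: "c > 0" using \<rho> R0 by (simp add: c_def)
  have near: "\<bar>z - of_int p / real q\<bar> \<le> \<rho> / R ^ Suc b"
    if "q \<ge> 1" "R ^ b \<le> (real q)\<^sup>2" "real q * \<bar>real q * z - of_int p\<bar> \<le> c" for z p q b
  proof -
    have q: "real q > 0" using that by simp
    have "real q * z - of_int p = real q * (z - of_int p / real q)" using q by (simp add: right_diff_distrib)
    then have "(real q)\<^sup>2 * \<bar>z - of_int p / real q\<bar> \<le> c"
      using that(3) by (simp add: abs_mult power2_eq_square mult.assoc)
    then have "R ^ b * \<bar>z - of_int p / real q\<bar> \<le> c"
      using mult_right_mono[OF that(2), of "\<bar>z - of_int p / real q\<bar>"] by linarith
    then show ?thesis using R0 by (simp add: c_def field_simps)
  qed
  have confined: "\<exists>d. W n b \<inter> cball y (\<rho> / R ^ b) \<subseteq> cball d (\<rho> / R ^ n)" for n b y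
  proof (cases "W n b \<inter> cball y (\<rho> / R ^ b) = {}")
    case False
    then obtain z where z: "z \<in> W n b" "\<bar>z - y\<bar> \<le> \<rho> / R ^ b"
      by (auto simp: dist_real_def abs_minus_commute)
    then have n: "n = Suc b" by (simp add: W_def)
    obtain p q where pq: "q \<ge> 1" "R ^ b \<le> (real q)\<^sup>2" "(real q)\<^sup>2 < R ^ n" "real q * \<bar>real q * z - of_int p\<bar> \<le> c"
      using z by (auto simp: W_def)
    show ?thesis
    proof (intro exI[of _ "of_int p / real q"] subsetI)
      fix z' assume "z' \<in> W n b \<inter> cball y (\<rho> / R ^ b)"
      then have z': "z' \<in> W n b" "\<bar>z' - y\<bar> \<le> \<rho> / R ^ b"
        by (auto simp: dist_real_def abs_minus_commute)
      then obtain p' q' where pq': "q' \<ge> 1" "R ^ b \<le> (real q')\<^sup>2" "(real q')\<^sup>2 < R ^ n"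
        "real q' * \<bar>real q' * z' - of_int p'\<bar> \<le> c"
        by (auto simp: W_def)
      note N = near[OF pq(1,2,4)] near[OF pq'(1,2,4)]
      have q: "real q > 0" "real q' > 0" using pq pq' by auto
      define x where "x = of_int p / real q"
      define x' where "x' = of_int p' / real q'"
      have "x = x'"
      proof (rule ccontr)
        assume "x \<noteq> x'"
        define D where "D = p * int q' - p' * int q"
        \<comment> \<open>a nonzero integer below one in absolute value\<close>
        have D: "of_int D = real q * real q' * (x - x')"
          using q by (simp add: D_def x_def x'_def field_simps)
        have "real_of_int D \<noteq> 0" unfolding D using \<open>x \<noteq> x'\<close> q by simp
        then have "D \<noteq> 0" by simp
        then have "1 \<le> \<bar>real_of_int D\<bar>" by linarith
        also have "\<dots> = real q * real q' * \<bar>x - x'\<bar>" using q by (simp add: D abs_mult)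
        also have "\<dots> \<le> R ^ n * \<bar>x - x'\<bar>"
        proof (rule mult_right_mono)
          show "real q * real q' \<le> R ^ n"
            using sum_squares_bound[of "real q" "real q'"] pq(3) pq'(3) by linarith
        qed simp
        also have "\<bar>x - x'\<bar> \<le> 4 * (\<rho> / R ^ b)"
        proof -
          have "\<rho> / R ^ Suc b \<le> \<rho> / R ^ b"
            using \<rho> R by (intro divide_left_mono power_increasing) auto
          then show ?thesis using N z(2) z'(2) unfolding x_def x'_def by linarith
        qed
        then have "R ^ n * \<bar>x - x'\<bar> \<le> R ^ n * (4 * (\<rho> / R ^ b))" using R0 by (intro mult_left_mono) auto
        also have "\<dots> = 1 / 2" using R0 by (simp add: n \<rho>_def)
        finally show False by simp
      qed
      then show "z' \<in> cball (of_int p / real q) (\<rho> / R ^ n)"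
        using N(2) by (simp add: x_def x'_def n dist_real_def abs_minus_commute)
    qed
  qed auto
  have "y \<in> BA" if avoid: "\<And>n b. b < n \<Longrightarrow> y \<notin> W n b" for y
  proof -
    have "real q * \<bar>real q * y - of_int p\<bar> > c" if q: "q \<ge> 1" for p :: int and q :: nat
    proof (rule ccontr)
      assume *: "\<not> real q * \<bar>real q * y - of_int p\<bar> > c"
      define n where "n = (LEAST n. (real q)\<^sup>2 < R ^ n)"
      have "\<exists>n. (real q)\<^sup>2 < R ^ n" using real_arch_pow[of R] R by auto
      then have n: "(real q)\<^sup>2 < R ^ n" unfolding n_def by (rule LeastI_ex)
      have "n \<noteq> 0" using n q by (intro notI) (simp add: power_less_one_iff)
      then obtain b where b: "n = Suc b" using not0_implies_Suc by blast
      then have "R ^ b \<le> (real q)\<^sup>2"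
        using not_less_Least[of b "\<lambda>n. (real q)\<^sup>2 < R ^ n"] by (simp add: n_def)
      then have "y \<in> W n b" using n q b * by (auto simp: W_def not_less)
      then show False using avoid[of b n] b by simp
    qed
    then show ?thesis using c by (auto simp: BA_def)
  qed
  moreover have "scattered R \<rho> W" using confined by (simp add: scattered_def)
  ultimately show ?thesis using \<rho> by blast
qed

text \<open>
  For the weight \<open>(1, 0)\<close> the condition concerns \<open>\<theta>\<close> alone, so there is nothing to avoid.
\<close>
lemma obstacles_on_fibre:
  assumes "i \<in> {0..1}" "j \<in> {0..1}" "i + j = 1" and \<theta>: "\<theta> \<in> Bad1 i" and R: "16 \<le> R"
  shows "\<exists>\<rho> W. 0 < \<rho> \<and> \<rho> < 1 \<and> scattered R \<rho> W \<and>
    (\<forall>y. (\<forall>n. \<forall>b<n. y \<notin> W n b) \<longrightarrow> (\<theta>, y) \<in> Bad i j)"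
proof -
  consider "0 < i" "0 < j" | "i = 0" "j = 1" | "i = 1" "j = 0" using assms by force
  then show ?thesis
  proof cases
    case 1
    then show ?thesis using weighted_obstacles assms by blast
  next
    case 2
    then have "(\<theta>, y) \<in> Bad i j \<longleftrightarrow> y \<in> BA" for y by (simp add: Bad_def)
    then show ?thesis using classical_obstacles[OF R] by simp
  next
    case 3
    then have "\<theta> \<in> BA" using \<theta> by (auto simp: Bad1_def BA_def)
    then have "(\<theta>, y) \<in> Bad i j" for y using 3 by (simp add: Bad_def)
    then show ?thesis by (intro exI[of _ "1/2"] exI[of _ "\<lambda>_ _. {}"]) (auto simp: scattered_def)
  qed
qed

section \<open>Passing between the line and the plane\<close>

text \<open>
  The map \<open>Pair \<theta>\<close> is an isometry onto the fibre.
\<close>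
lemma power_law_on_fibre:
  fixes N :: "real measure" and \<theta> :: real
  assumes "sets N = sets borel" "power_law N \<gamma>"
  defines "\<nu> \<equiv> distr N borel (Pair \<theta>)"
  shows "borel_measure_on UNIV \<nu>" "emeasure \<nu> (space \<nu>) = emeasure N (space N)"
    "power_law \<nu> \<gamma>" "supp \<nu> \<subseteq> Pair \<theta> ` supp N"
proof -
  have sp: "space N = UNIV" using sets_eq_imp_space_eq[OF assms(1)] by simp
  have meas: "Pair \<theta> \<in> measurable N borel"
    unfolding measurable_cong_sets[OF assms(1) refl]
    by (intro borel_measurable_continuous_onI continuous_intros)
  show "borel_measure_on UNIV \<nu>" by (simp add: borel_measure_on_def \<nu>_def)
  show "emeasure \<nu> (space \<nu>) = emeasure N (space N)"
    using meas by (simp add: \<nu>_def emeasure_distr sp)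
  have ball: "emeasure \<nu> (ball (\<theta>, y) r) = emeasure N (ball y r)" for y r
  proof -
    have "Pair \<theta> -` ball (\<theta>, y) r = ball y r" by (auto simp: dist_Pair_Pair)
    then show ?thesis using meas by (simp add: \<nu>_def emeasure_distr sp)
  qed
  show supp: "supp \<nu> \<subseteq> Pair \<theta> ` supp N"
  proof
    fix x assume x: "x \<in> supp \<nu>"
    obtain a y where ay: "x = (a, y)" by fastforce
    have "a = \<theta>"
    proof (rule ccontr)
      assume "a \<noteq> \<theta>"
      have "Pair \<theta> -` ball (a, y) (dist a \<theta>) = {}"
      proof -
        have "dist a \<theta> \<le> dist (a, y) (\<theta>, z)" for z
          using dist_fst_le[of "(a, y)" "(\<theta>, z)"] by simp
        then show ?thesis by (auto simp: not_less[symmetric])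
      qed
      then have "emeasure \<nu> (ball x (dist a \<theta>)) = 0"
        using meas by (simp add: \<nu>_def emeasure_distr ay)
      moreover have "emeasure \<nu> (ball x (dist a \<theta>)) > 0"
        using x \<open>a \<noteq> \<theta>\<close> by (simp add: supp_def \<nu>_def)
      ultimately show False by simp
    qed
    then show "x \<in> Pair \<theta> ` supp N"
      using x ball by (auto simp: supp_def ay \<nu>_def sp)
  qed
  show "power_law \<nu> \<gamma>"
  proof -
    obtain b1 b2 where "b1 > 0" "b2 > 0" and b: "\<And>y r. y \<in> supp N \<Longrightarrow> 0 < r \<Longrightarrow> r < 1 \<Longrightarrow>
      ennreal (b1 * r powr \<gamma>) \<le> emeasure N (ball y r) \<and> emeasure N (ball y r) \<le> ennreal (b2 * r powr \<gamma>)"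
      and "\<gamma> > 0"
      using assms(2) by (auto simp: power_law_def sp)
    moreover have "ennreal (b1 * r powr \<gamma>) \<le> emeasure \<nu> (ball x r) \<and> emeasure \<nu> (ball x r) \<le> ennreal (b2 * r powr \<gamma>)"
      if "x \<in> supp \<nu>" "0 < r" "r < 1" for x r
      using supp that b by (auto simp: ball)
    moreover have sp\<nu>: "space \<nu> = UNIV" by (simp add: \<nu>_def)
    ultimately show ?thesis unfolding power_law_def sp\<nu> Int_UNIV_right by blast
  qed
qed

theorem theorem6:
  fixes i j \<theta> \<beta> :: real
    and \<Theta> C :: "(real \<times> real) set"
    and \<mu> :: "(real \<times> real) measure"
  assumes "i \<in> {0..1}" and "j \<in> {0..1}" and "i + j = 1"
    and "\<theta> \<in> Bad1 i"
    and "\<Theta> = {(\<theta>, y) | y. y \<in> {0..1}}"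
    and "borel_measure_on \<Theta> \<mu>" and "prob_space \<mu>"
    and "C \<subseteq> \<Theta>" and "C = supp \<mu>"
    and "power_law \<mu> \<beta>"
  shows "(\<forall>\<beta>'<\<beta>. \<exists>(\<nu> :: (real \<times> real) measure) \<gamma>.
            borel_measure_on UNIV \<nu> \<and> emeasure \<nu> (space \<nu>) \<noteq> 0 \<and>
            \<gamma> > \<beta>' \<and> power_law \<nu> \<gamma> \<and> supp \<nu> \<subseteq> Bad i j \<inter> C) \<and>
         hausdorff_dim (Bad i j \<inter> C) = ennreal \<beta>"
proof -
  interpret \<mu>: prob_space \<mu> by fact
  have "\<beta> > 0" using assms(10) by (simp add: power_law_def)
  have "closed \<Theta>"
  proof -
    have "\<Theta> = {\<theta>} \<times> {0..1}" using assms(5) by auto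
    then show ?thesis by (simp add: closed_Times)
  qed
  then have "closed C" using closed_supp[OF assms(6)] assms(9) by simp
  have "C \<noteq> {}" using supp_nonempty[OF assms(6)] \<mu>.emeasure_space_1 assms(9) by simp
  define C' where "C' = {y. (\<theta>, y) \<in> C}"
  have CC': "C = Pair \<theta> ` C'" using assms(5,8) by (auto simp: C'_def)
  have "closed C'"
  proof -
    have "C' = Pair \<theta> -` C" by (auto simp: C'_def)
    then show ?thesis using \<open>closed C\<close> by (auto intro!: closed_vimage continuous_intros)
  qed
  obtain a where "a > 0" and sep: "\<And>x r t. x \<in> C \<Longrightarrow> 0 < r \<Longrightarrow> r < 1 \<Longrightarrow> 0 < t \<Longrightarrow> t < 1 \<Longrightarrow>
    \<exists>S \<subseteq> C \<inter> ball x r. separated t S \<and> a * (r / t) powr \<beta> \<le> real (card S)"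
    using power_law_separated_subsets[OF assms(6,10)] unfolding assms(9)[symmetric] by metis
  have sep': "\<exists>S \<subseteq> C' \<inter> ball y r. separated t S \<and> a * (r / t) powr \<beta> \<le> real (card S)"
    if y: "y \<in> C'" and rt: "0 < r" "r < 1" "0 < t" "t < 1" for y r t
  proof -
    obtain S where S: "S \<subseteq> C \<inter> ball (\<theta>, y) r" "separated t S" "a * (r / t) powr \<beta> \<le> real (card S)"
      using sep[of "(\<theta>, y)" r t] y rt by (auto simp: C'_def)
    define S' where "S' = {z. (\<theta>, z) \<in> S}"
    have SS': "S = Pair \<theta> ` S'" using S(1) CC' by (auto simp: S'_def)
    have "inj (Pair \<theta>)" by (auto simp: inj_def)
    then have "card S = card S'" "finite S \<longleftrightarrow> finite S'"
      unfolding SS' using card_image[of "Pair \<theta>" S'] finite_image_iff[of "Pair \<theta>" S']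
      by (auto intro: inj_on_subset)
    moreover have "S' \<subseteq> C' \<inter> ball y r"
      using S(1) by (auto simp: S'_def C'_def dist_Pair_Pair)
    ultimately show ?thesis
      using S(2,3) by (intro exI[of _ S']) (auto simp: separated_def SS' dist_Pair_Pair)
  qed
  have main: "\<exists>(\<nu> :: (real \<times> real) measure) \<gamma>. borel_measure_on UNIV \<nu> \<and> emeasure \<nu> (space \<nu>) \<noteq> 0 \<and>
      \<gamma> > \<beta>' \<and> power_law \<nu> \<gamma> \<and> supp \<nu> \<subseteq> Bad i j \<inter> C" if "\<beta>' < \<beta>" for \<beta>'
  proof -
    have "C' \<noteq> {}" using \<open>C \<noteq> {}\<close> CC' by auto
    from cantor_measure_avoiding_obstacles[OF \<open>closed C'\<close> this \<open>a > 0\<close> \<open>\<beta> > 0\<close> that sep']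
    obtain R0 where R0: "\<forall>R\<ge>R0. \<forall>\<rho>. \<forall>W. 0 < \<rho> \<and> \<rho> < 1 \<and> scattered R \<rho> W \<longrightarrow>
      (\<exists>(N :: real measure) \<gamma>. sets N = sets borel \<and> prob_space N \<and> \<beta>' < \<gamma> \<and> power_law N \<gamma> \<and>
        supp N \<subseteq> C' - (\<Union>n. \<Union>b<n. W n b))" by blast
    define R where "R = max R0 16"
    have R: "R0 \<le> R" "16 \<le> R" by (auto simp: R_def)
    obtain \<rho> W where W: "0 < \<rho> \<and> \<rho> < 1 \<and> scattered R \<rho> W"
      and bad: "\<forall>y. (\<forall>n. \<forall>b<n. y \<notin> W n b) \<longrightarrow> (\<theta>, y) \<in> Bad i j"
      using obstacles_on_fibre[OF assms(1-4) R(2)] by blast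
    obtain N \<gamma> where N: "sets N = sets borel" "prob_space N" "\<beta>' < \<gamma>" "power_law N \<gamma>"
      "supp N \<subseteq> C' - (\<Union>n. \<Union>b<n. W n b)"
      using R0 R(1) W by blast
    note \<nu> = power_law_on_fibre[OF N(1,4), of \<theta>]
    have "Pair \<theta> ` supp N \<subseteq> Bad i j \<inter> C"
      using N(5) bad by (auto simp: C'_def)
    then have "supp (distr N borel (Pair \<theta>)) \<subseteq> Bad i j \<inter> C" using \<nu>(4) by blast
    moreover have "emeasure N (space N) \<noteq> 0" using prob_space.emeasure_space_1[OF N(2)] by simp
    ultimately show ?thesis
      using \<nu>(1-3) N(3) by (intro exI[of _ "distr N borel (Pair \<theta>)"] exI[of _ \<gamma>]) simp
  qed
  have "hausdorff_dim (Bad i j \<inter> C) = ennreal \<beta>"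
    by (rule hausdorff_dim_eqI[OF assms(6) \<mu>.finite_measure_axioms assms(10) _ main])
      (use assms(9) in auto)
  then show ?thesis using main by blast
qed

end
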